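(* For every integer $n \geq 4$, $\mathrm{ex}_{\mathcal{P}}(n,C_3,C_4) \leq \frac{5}{7}(n-2)$, and this bound is attained (with equality) for infinitely many values of $n$.
   Context: For graphs $H$ and $F$, $\mathrm{ex}_{\mathcal{P}}(n,H,F)$ denotes the maximum number of copies of $H$ (subgraphs isomorphic to $H$) in an $n$-vertex simple planar graph that contains no subgraph isomorphic to $F$. $C_l$ denotes the cycle of length $l$. *)

theory Defs
  imports "HOL-Analysis.Analysis"
begin

text \<open>A graph is a pair of a vertex set and a set of edges, each edge being the set of its
  two end vertices.\<close>

type_synonym 'a graph = "'a set \<times> 'a set set"

abbreviation verts :: "'a graph \<Rightarrow> 'a set" where
  "verts G \<equiv> fst G"

abbreviation edges :: "'a graph \<Rightarrow> 'a set set" where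
  "edges G \<equiv> snd G"

definition simple_graph :: "'a graph \<Rightarrow> bool" where
  "simple_graph G \<longleftrightarrow> finite (verts G) \<and> (\<forall>e\<in>edges G. e \<subseteq> verts G \<and> card e = 2)"

definition is_subgraph :: "'a graph \<Rightarrow> 'a graph \<Rightarrow> bool" where
  "is_subgraph H G \<longleftrightarrow> simple_graph H \<and> verts H \<subseteq> verts G \<and> edges H \<subseteq> edges G"

definition graph_iso :: "'a graph \<Rightarrow> 'b graph \<Rightarrow> bool" where
  "graph_iso G H \<longleftrightarrow>
     (\<exists>f. bij_betw f (verts G) (verts H) \<and> edges H = (\<lambda>e. f ` e) ` edges G)"

definition copies :: "'h graph \<Rightarrow> 'a graph \<Rightarrow> 'a graph set" where
  "copies H G = {H'. is_subgraph H' G \<and> graph_iso H H'}"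

definition contains_copy :: "'a graph \<Rightarrow> 'f graph \<Rightarrow> bool" where
  "contains_copy G F \<longleftrightarrow> copies F G \<noteq> {}"

text \<open>A drawing in the plane, identified with the complex numbers: vertices are distinct points,
  each edge is an arc (injective path) joining its two end vertices and passing through no
  other vertex, and distinct edges meet at most in common end vertices.\<close>

definition plane_drawing ::
    "'a graph \<Rightarrow> ('a \<Rightarrow> complex) \<Rightarrow> ('a set \<Rightarrow> real \<Rightarrow> complex) \<Rightarrow> bool" where
  "plane_drawing G p \<gamma> \<longleftrightarrow>
     inj_on p (verts G) \<and>
     (\<forall>e\<in>edges G. arc (\<gamma> e) \<and> {pathstart (\<gamma> e), pathfinish (\<gamma> e)} = p ` e \<and>
        path_image (\<gamma> e) \<inter> p ` verts G = p ` e) \<and>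
     (\<forall>e\<in>edges G. \<forall>e'\<in>edges G. e \<noteq> e' \<longrightarrow>
        path_image (\<gamma> e) \<inter> path_image (\<gamma> e') \<subseteq> p ` (e \<inter> e'))"

definition planar :: "'a graph \<Rightarrow> bool" where
  "planar G \<longleftrightarrow> (\<exists>p \<gamma>. plane_drawing G p \<gamma>)"

text \<open>This is the cycle of length \<open>l\<close> for \<open>l \<ge> 3\<close> only.\<close>

definition cycle_graph :: "nat \<Rightarrow> nat graph" where
  "cycle_graph l = ({..<l}, (\<lambda>i. {i, (i + 1) mod l}) ` {..<l})"

text \<open>Vertices are taken to be natural numbers; every finite graph is isomorphic to such a graph.
  For fixed \<open>n\<close> and finite \<open>H\<close> the set of counts is bounded, and it is nonempty whenever \<open>F\<close>
  has an edge (take the edgeless graph), so that the maximum is a genuine one.\<close>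

definition ex_planar :: "nat \<Rightarrow> 'h graph \<Rightarrow> 'f graph \<Rightarrow> nat" where
  "ex_planar n H F =
     Max {card (copies H G) | G :: nat graph.
            simple_graph G \<and> card (verts G) = n \<and> planar G \<and> \<not> contains_copy G F}"

end

theory Submission
  imports Defs
begin

text \<open>
  Upper bound. Two triangles sharing an edge form a four-cycle, so the \<open>t\<close> triangles are
  edge-disjoint; discarding all other edges leaves a plane graph with \<open>e = 3 t\<close> edges. Adding the
  edges one at a time shows that it has at least \<open>e - n + 2\<close> faces. Every edge lies on a triangle,
  which separates the two sides of the edge, and so borders at most two faces. A face
  bordered by at most four edges is bordered by exactly one triangle: a forest does not separate the
  plane, and a fourth edge would drag the rest of its own triangle into the face. Double counting
  the incidences of edges and faces gives \<open>5 f \<le> 2 e + 2 t\<close>, whence \<open>7 t \<le> 5 (n - 2)\<close>.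

  Sharpness. The bound is attained when all faces are triangles and pentagons and every edge borders
  one of each. The icosidodecahedron has this property, and so do the graphs obtained from
  it by repeatedly inserting a band of 14 vertices and 10 triangles. Drawn in nested
  rings, the bands are images of one another under multiplication by \<open>-2 i\<close>; planarity and the absence
  of four-cycles therefore reduce to finitely many checks on neighbouring bands.
\<close>

section \<open>Adding an arc to a closed plane set\<close>

text \<open>Faces are never described by boundary walks. The pruned graph may be disconnected and
  have isolated vertices, so Euler's equation for connected graphs gives way to an inequality, and
  the border of a face is just the set of edges whose interiors its closure meets. What replaces
  boundary walks is that a face remains a component when all edges off its border are erased; a
  border of at most four edges is then small enough for the Jordan curve theorem and Janiszewski's
  theorem. Lower bounds on faces are stated for finite families of components, because
  \<open>card\<close> is 0 on infinite sets. A band keeps the equation 7 t = 5 (n - 2) because 7 *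
  10 = 5 * 14. The spiral graph with parameter \<open>M\<close> has n = 14 M + 16 and t = 10 (M +
  1); \<open>M = 1\<close> gives the 30 vertices and 20 triangles of the icosidodecahedron.
  Sharpness is shown from \<open>M = 3\<close> on, where no three consecutive parts include both
  special ends.\<close>

lemma simple_path_subset_closure:
  assumes "simple_path c"
  shows "path_image c \<subseteq> closure (path_image c - {pathstart c, pathfinish c})"
proof -
  have "continuous_on (closure {0<..<1}) c"
    using assms by (simp add: simple_path_def path_def)
  then have "c ` closure {0<..<1} \<subseteq> closure (c ` {0<..<1})"
    by (intro image_closure_subset) (auto simp: closure_subset)
  then show ?thesis
    unfolding simple_path_endless [OF assms] by (simp add: path_image_def)
qed

text \<open>By invariance of dimension: the inverse of the arc would map \<open>U\<close>
  injectively and continuously into the line. Hence an arc cannot exhaust a face.\<close>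

lemma open_not_subset_arc:
  fixes g :: "real \<Rightarrow> complex"
  assumes g: "arc g" and U: "open U" "U \<noteq> {}"
  shows "\<not> U \<subseteq> path_image g"
proof
  assume sub: "U \<subseteq> path_image g"
  have "inj_on g {0..1}" "continuous_on {0..1} g"
    using g by (auto simp: arc_def path_def)
  then obtain h where h: "homeomorphism {0..1} (g ` {0..1}) g h"
    using homeomorphism_compact [of "{0..1::real}" g] by auto
  then have "continuous_on (path_image g) h" "inj_on h (path_image g)"
    unfolding path_image_def homeomorphism_def inj_on_def by metis+
  then have "DIM(complex) \<le> DIM(real)"
    using U sub by (intro invariance_of_dimension [of U h])
      (auto intro: continuous_on_subset inj_on_subset)
  then show False by simp
qed

lemma component_avoiding:
  assumes "W \<in> components (- K)" "W \<inter> S = {}"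
  shows "W \<in> components (- (K \<union> S))"
  using assms by (intro components_intermediate_subset [OF assms(1)]) (auto dest: in_components_subset)

text \<open>An arc joining two points that are already joined within \<open>K\<close> closes a Jordan curve,
  and every point of that curve lies on the boundary of both of its sides.\<close>

lemma components_add_closing_arc:
  fixes K :: "complex set"
  assumes K: "closed K" and g: "arc g" and a: "arc a" "path_image a \<subseteq> K"
    and ends: "pathstart a = pathstart g" "pathfinish a = pathfinish g"
    and meet: "path_image g \<inter> K \<subseteq> {pathstart g, pathfinish g}"
    and F: "finite F" "F \<subseteq> components (- K)"
  shows "\<exists>F'. finite F' \<and> F' \<subseteq> components (- (K \<union> path_image g)) \<and> card F + 1 \<le> card F'"
proof -
  define c where "c = g +++ reversepath a"
  define I where "I = path_image g - {pathstart g, pathfinish g}"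
  have c: "simple_path c" "pathfinish c = pathstart c"
    unfolding c_def
  proof -
    have "path_image g \<inter> path_image a \<subseteq> {pathstart g, pathfinish g}"
      using a(2) meet by blast
    then show "simple_path (g +++ reversepath a)"
      using g a(1) ends by (intro simple_path_join_loop) (auto simp: arc_reversepath)
  qed (simp add: ends)
  have pc: "path_image c = path_image g \<union> path_image a"
    unfolding c_def using ends by (simp add: path_image_join)
  note J = Jordan_inside_outside [OF c]
  have I: "I \<noteq> {}" "connected I"
    unfolding I_def by (rule nonempty_simple_path_endless connected_simple_path_endless
        arc_imp_simple_path g)+
  have "I \<subseteq> - K" unfolding I_def using meet by blast
  note I = I this
  obtain x where x: "x \<in> I" using I by auto
  define U where "U = connected_component_set (- K) x"
  have xK: "x \<in> - K" using x I(3) by auto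
  have U: "open U" "U \<in> components (- K)"
    unfolding U_def by (rule open_connected_component open_Compl K componentsI xK)+
  have UK: "U \<subseteq> - K" unfolding U_def by (rule connected_component_subset)
  have IU: "I \<subseteq> U" unfolding U_def by (rule connected_component_maximal [OF x I(2,3)])
  define In where "In = inside (path_image c)"
  define Out where "Out = outside (path_image c)"
  have sides: "open In" "open Out" "In \<inter> Out = {}" "In \<union> Out = - path_image c"
    and fr: "frontier In = path_image c" "frontier Out = path_image c"
    using J by (simp_all add: In_def Out_def)
  \<comment> \<open>\<open>x\<close> lies on the Jordan curve, hence in the closure of both sides,
    and \<open>U\<close> is a neighbourhood of \<open>x\<close>. So \<open>U\<close> reaches both
    sides.\<close>
  have "x \<in> path_image c" using x pc by (auto simp: I_def)
  then have "x \<in> closure In" "x \<in> closure Out"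
    using fr by (auto simp: frontier_def)
  moreover have "x \<in> U" using x IU by blast
  ultimately have "U \<inter> In \<noteq> {}" "U \<inter> Out \<noteq> {}"
    using open_Int_closure_eq_empty [OF U(1)] by blast+
  then obtain y z where y: "y \<in> U" "y \<in> In" and z: "z \<in> U" "z \<in> Out" by auto
  define L where "L = - (K \<union> path_image g)"
  define Y where "Y = connected_component_set L y"
  define Z where "Z = connected_component_set L z"
  have yzL: "y \<in> L" "z \<in> L"
    unfolding L_def using y z UK sides(4) pc by auto
  have YZ: "Y \<in> components L" "Z \<in> components L" "y \<in> Y" "z \<in> Z"
    unfolding Y_def Z_def using yzL by (auto simp: componentsI)
  \<comment> \<open>All of \<open>c\<close> is missing from \<open>L\<close>, so a connected subset
    of \<open>L\<close> stays on one side of it.\<close>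
  have Lc: "L \<subseteq> In \<union> Out" unfolding L_def sides(4) pc using a(2) by auto
  have "Y \<noteq> Z"
  proof
    assume YZeq: "Y = Z"
    have "connected Y" "Y \<subseteq> L"
      unfolding Y_def by (rule connected_connected_component connected_component_subset)+
    then show False
      using connectedD [OF \<open>connected Y\<close> sides(1,2)] sides(3) Lc YZ(3,4) YZeq y z by auto
  qed
  have YU: "Y \<subseteq> U" "Z \<subseteq> U"
  proof -
    have "L \<subseteq> - K" by (auto simp: L_def)
    moreover have "connected_component_set (- K) y = U" "connected_component_set (- K) z = U"
      using connected_component_eq [OF y(1) [unfolded U_def]]
        connected_component_eq [OF z(1) [unfolded U_def]] unfolding U_def by simp_all
    ultimately show "Y \<subseteq> U" "Z \<subseteq> U"
      unfolding Y_def Z_def using connected_component_mono [of L "- K"] by blast+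
  qed
  have "pathstart g \<in> K" "pathfinish g \<in> K"
    using a(2) ends pathstart_in_path_image [of a] pathfinish_in_path_image [of a] by auto
  then have gU: "path_image g \<subseteq> U \<union> K"
    using IU unfolding I_def by blast
  \<comment> \<open>The interior of the arc lies in \<open>U\<close>, so every other component in
    the family survives unchanged.\<close>
  have other: "W \<in> components L \<and> W \<noteq> Y \<and> W \<noteq> Z" if W: "W \<in> F - {U}" for W
  proof -
    have WK: "W \<in> components (- K)" using W F by auto
    have dis: "W \<inter> U = {}" using components_nonoverlap [OF WK U(2)] W by auto
    moreover have "W \<inter> K = {}" using in_components_subset [OF WK] by auto
    ultimately have "W \<inter> path_image g = {}" using gU by auto
    then have "W \<in> components L" unfolding L_def using WK by (rule component_avoiding [rotated])
    moreover have "W \<noteq> {}" using in_components_nonempty [OF WK] .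
    ultimately show ?thesis using dis YU by auto
  qed
  let ?F = "insert Y (insert Z (F - {U}))"
  have "card ?F = card (F - {U}) + 2"
  proof -
    have "Z \<notin> F - {U}" "Y \<notin> insert Z (F - {U})"
      using other \<open>Y \<noteq> Z\<close> by blast+
    then show ?thesis using F(1) by simp
  qed
  \<comment> \<open>If \<open>U\<close> is not in \<open>F\<close>, two components are gained
    instead of one.\<close>
  moreover have "card F \<le> card (F - {U}) + 1"
  proof (cases "U \<in> F")
    case True
    show ?thesis using card_Suc_Diff1 [OF F(1) True] by linarith
  qed simp
  ultimately show ?thesis
    using other YZ F(1) unfolding L_def by (intro exI [of _ ?F]) auto
qed

text \<open>An arc has empty interior, so each component keeps a point off the arc; the new
  component of that point lies inside the old one. Components may split but are never lost.\<close>

lemma components_add_arc: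
  fixes K :: "complex set"
  assumes K: "closed K" and g: "arc g" and F: "finite F" "F \<subseteq> components (- K)"
  shows "\<exists>F'. finite F' \<and> F' \<subseteq> components (- (K \<union> path_image g)) \<and> card F \<le> card F'"
proof -
  have "\<exists>W'. W' \<in> components (- (K \<union> path_image g)) \<and> W' \<subseteq> W" if "W \<in> F" for W
  proof -
    have W: "W \<in> components (- K)" using that F by auto
    then have "open W" "W \<noteq> {}"
      using open_components [OF open_Compl [OF K] W] in_components_nonempty [OF W] by simp_all
    then obtain x where x: "x \<in> W" "x \<notin> path_image g"
      using open_not_subset_arc [OF g] by blast
    define C where "C = connected_component_set (- (K \<union> path_image g)) x"
    have "x \<in> - (K \<union> path_image g)" using x in_components_subset [OF W] by auto
    then have "x \<in> C" "C \<in> components (- (K \<union> path_image g))"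
      unfolding C_def by (simp_all add: componentsI)
    moreover have "C \<subseteq> - K" using connected_component_subset [of "- (K \<union> path_image g)" x] unfolding C_def by auto
    then have "C \<subseteq> W"
      using x(1) \<open>x \<in> C\<close> unfolding C_def by (intro components_maximal [OF W]) auto
    ultimately show ?thesis by blast
  qed
  then obtain f where f: "\<And>W. W \<in> F \<Longrightarrow> f W \<in> components (- (K \<union> path_image g)) \<and> f W \<subseteq> W"
    by metis
  have "inj_on f F"
  proof (rule inj_onI)
    fix W W' assume W: "W \<in> F" "W' \<in> F" "f W = f W'"
    have "f W \<noteq> {}" using f [OF W(1)] in_components_nonempty by auto
    then have "W \<inter> W' \<noteq> {}" using f [OF W(1)] f [OF W(2)] W(3) by auto
    then show "W = W'"
      using components_nonoverlap [of W "- K" W'] W(1,2) F(2) by auto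
  qed
  then have "card (f ` F) = card F" by (rule card_image)
  then show ?thesis using f F(1) by (intro exI [of _ "f ` F"]) auto
qed

section \<open>Faces of a plane graph\<close>

locale plane_graph =
  fixes V :: "'a set" and E :: "'a set set" and p :: "'a \<Rightarrow> complex"
    and \<gamma> :: "'a set \<Rightarrow> real \<Rightarrow> complex"
  assumes simple: "simple_graph (V, E)" and drawing: "plane_drawing (V, E) p \<gamma>"
begin

definition curve :: "'a set \<Rightarrow> complex set" where
  "curve e = path_image (\<gamma> e)"

definition open_curve :: "'a set \<Rightarrow> complex set" where
  "open_curve e = curve e - p ` e"

definition drawn :: "'a set set \<Rightarrow> complex set" where
  "drawn X = \<Union> (curve ` X)"

lemma finite_V: "finite V" and finite_E: "finite E"
proof -
  show "finite V" using simple by (simp add: simple_graph_def)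
  moreover have "E \<subseteq> Pow V" using simple by (auto simp: simple_graph_def)
  ultimately show "finite E" by (meson finite_Pow_iff finite_subset)
qed

lemma edge_ends: "e \<in> E \<Longrightarrow> \<exists>u v. e = {u, v} \<and> u \<noteq> v \<and> u \<in> V \<and> v \<in> V"
  using simple unfolding simple_graph_def card_2_iff by (metis insert_subset snd_conv fst_conv)

lemma edge_subset: "e \<in> E \<Longrightarrow> e \<subseteq> V"
  using simple by (auto simp: simple_graph_def)

lemma inj_p: "inj_on p V"
  using drawing by (simp add: plane_drawing_def)

lemma arc_edge: "e \<in> E \<Longrightarrow> arc (\<gamma> e)"
  and path_ends: "e \<in> E \<Longrightarrow> {pathstart (\<gamma> e), pathfinish (\<gamma> e)} = p ` e"
  and curve_verts: "e \<in> E \<Longrightarrow> curve e \<inter> p ` V = p ` e"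
  and curve_meet: "e \<in> E \<Longrightarrow> e' \<in> E \<Longrightarrow> e \<noteq> e' \<Longrightarrow> curve e \<inter> curve e' \<subseteq> p ` (e \<inter> e')"
  using drawing by (simp_all add: plane_drawing_def curve_def)

lemma compact_curve: "e \<in> E \<Longrightarrow> compact (curve e)"
  unfolding curve_def by (simp add: arc_edge compact_arc_image)

lemma connected_curve: "e \<in> E \<Longrightarrow> connected (curve e)"
  unfolding curve_def by (simp add: arc_edge connected_arc_image)

lemma ends_subset_curve: "e \<in> E \<Longrightarrow> p ` e \<subseteq> curve e"
  using curve_verts by blast

lemma open_curve_eq: "e \<in> E \<Longrightarrow> open_curve e = path_image (\<gamma> e) - {pathstart (\<gamma> e), pathfinish (\<gamma> e)}"
  by (simp add: open_curve_def curve_def path_ends)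

lemma open_curve_nonempty: "e \<in> E \<Longrightarrow> open_curve e \<noteq> {}"
  and connected_open_curve: "e \<in> E \<Longrightarrow> connected (open_curve e)"
  and curve_subset_closure_open_curve: "e \<in> E \<Longrightarrow> curve e \<subseteq> closure (open_curve e)"
  unfolding curve_def
  by (simp_all only: open_curve_eq nonempty_simple_path_endless connected_simple_path_endless
      simple_path_subset_closure arc_imp_simple_path arc_edge not_False_eq_True)

lemma open_curve_disjoint: "e \<in> E \<Longrightarrow> e' \<in> E \<Longrightarrow> e \<noteq> e' \<Longrightarrow> open_curve e \<inter> curve e' = {}"
  using curve_meet unfolding open_curve_def by blast

lemma open_curve_no_vertex: "e \<in> E \<Longrightarrow> open_curve e \<inter> p ` V = {}"
  using curve_verts unfolding open_curve_def by blast

lemma compact_drawn: "X \<subseteq> E \<Longrightarrow> compact (drawn X)"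
  unfolding drawn_def using finite_subset [OF _ finite_E] compact_curve
  by (intro compact_UN) auto

lemma closed_part: "X \<subseteq> E \<Longrightarrow> closed (p ` V \<union> drawn X)"
  by (simp add: closed_Un compact_drawn compact_imp_closed finite_V finite_imp_closed)

lemma drawn_insert: "drawn (insert e X) = drawn X \<union> curve e"
  by (auto simp: drawn_def)

lemma curve_meets_part:
  assumes "e \<in> E" "X \<subseteq> E" "e \<notin> X"
  shows "curve e \<inter> (p ` V \<union> drawn X) = p ` e"
proof
  show "curve e \<inter> (p ` V \<union> drawn X) \<subseteq> p ` e"
    using assms curve_verts [of e] curve_meet [of e] unfolding drawn_def by blast
  show "p ` e \<subseteq> curve e \<inter> (p ` V \<union> drawn X)"
    using assms curve_verts [of e] by blast
qed

text \<open>Equal labels under \<open>l\<close> guarantee a connection within the drawing. An edge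
  between equal labels closes a curve and gains a face; an edge between different labels merges two
  labels and loses no face. The inequality survives either way, without any record of the exact
  components of the graph.\<close>

lemma faces_induct:
  assumes "X \<subseteq> E"
  shows "\<exists>(l :: 'a \<Rightarrow> 'a) F. finite F \<and> F \<subseteq> components (- (p ` V \<union> drawn X)) \<and>
    (\<forall>u\<in>V. \<forall>v\<in>V. l u = l v \<longrightarrow> path_component (p ` V \<union> drawn X) (p u) (p v)) \<and>
    card X + 1 + card (l ` V) \<le> card F + card V"
  using finite_subset [OF assms finite_E] assms
proof (induction X rule: finite_induct)
  case empty
  have "connected (UNIV - p ` V)"
    by (intro connected_open_delete_finite) (auto simp: finite_V)
  moreover have "UNIV - p ` V \<noteq> {}"
    by (metis Diff_eq_empty_iff finite_V finite_imageI finite_subset infinite_UNIV_char_0)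
  ultimately have "components (- (p ` V \<union> drawn {})) = {- (p ` V)}"
    by (simp add: drawn_def components_eq_sing_iff Compl_eq_Diff_UNIV)
  then show ?case
    using inj_p by (intro exI [of _ id] exI [of _ "{- (p ` V)}"]) (auto simp: path_component_refl)
next
  case (insert e X)
  let ?K = "p ` V \<union> drawn X"
  obtain l :: "'a \<Rightarrow> 'a" and F where F: "finite F" "F \<subseteq> components (- ?K)"
    and l: "\<And>u v. u \<in> V \<Longrightarrow> v \<in> V \<Longrightarrow> l u = l v \<Longrightarrow> path_component ?K (p u) (p v)"
    and card: "card X + 1 + card (l ` V) \<le> card F + card V"
    using insert by blast
  have e: "e \<in> E" and X: "X \<subseteq> E" using insert by auto
  obtain u v where uv: "e = {u, v}" "u \<noteq> v" "u \<in> V" "v \<in> V" using edge_ends [OF e] by blast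
  have closed: "closed ?K" using X by (rule closed_part)
  have K': "p ` V \<union> drawn (insert e X) = ?K \<union> path_image (\<gamma> e)"
    by (simp add: drawn_insert curve_def Un_assoc)
  have mono: "path_component ?K a b \<Longrightarrow> path_component (?K \<union> path_image (\<gamma> e)) a b" for a b
    by (rule path_component_of_subset) auto
  show ?case
  proof (cases "l u = l v")
    case True
    define s t where "s = pathstart (\<gamma> e)" and "t = pathfinish (\<gamma> e)"
    have st: "{s, t} = {p u, p v}" "s \<noteq> t"
      using path_ends [OF e] uv arc_distinct_ends [OF arc_edge [OF e]] by (auto simp: s_def t_def)
    have "path_component ?K (p u) (p v)" using l uv True by blast
    then have "path_component ?K s t"
      using st by (metis doubleton_eq_iff path_component_sym)
    then obtain q where "path q" "path_image q \<subseteq> ?K" "pathstart q = s" "pathfinish q = t"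
      by (auto simp: path_component_def)
    then obtain a where a: "arc a" "path_image a \<subseteq> ?K" "pathstart a = s" "pathfinish a = t"
      using path_contains_arc st by (metis subset_trans)
    have "\<exists>F'. finite F' \<and> F' \<subseteq> components (- (?K \<union> path_image (\<gamma> e))) \<and> card F + 1 \<le> card F'"
      using a curve_meets_part [OF e X] insert(2) path_ends [OF e]
      by (intro components_add_closing_arc [OF closed arc_edge [OF e] a(1,2) _ _ _ F])
        (auto simp: s_def t_def curve_def)
    then obtain F' where "finite F'" "F' \<subseteq> components (- (?K \<union> path_image (\<gamma> e)))"
      "card F + 1 \<le> card F'" by blast
    moreover have "\<forall>u\<in>V. \<forall>v\<in>V. l u = l v \<longrightarrow>
        path_component (?K \<union> path_image (\<gamma> e)) (p u) (p v)"
      using l mono by blast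
    ultimately show ?thesis
      unfolding K' using card insert(1,2) by (intro exI [of _ l] exI [of _ F']) auto
  next
    case False
    obtain F' where F': "finite F'" "F' \<subseteq> components (- (?K \<union> path_image (\<gamma> e)))"
      "card F \<le> card F'"
      using components_add_arc [OF closed arc_edge [OF e] F] by blast
    \<comment> \<open>The class of \<open>u\<close> is absorbed into that of \<open>v\<close>, so
      the label of \<open>u\<close> disappears from the image.\<close>
    define l' where "l' w = (if l w = l u then l v else l w)" for w
    have "l' ` V \<subseteq> l ` V - {l u}" using uv False by (auto simp: l'_def)
    then have "card (l' ` V) \<le> card (l ` V - {l u})"
      using finite_V by (intro card_mono) auto
    moreover have "card (l ` V) = Suc (card (l ` V - {l u}))"
      using uv finite_V by (intro card.remove) auto
    ultimately have c: "card (l' ` V) + 1 \<le> card (l ` V)" by simp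
    let ?R = "path_component (?K \<union> path_image (\<gamma> e))"
    have "path_component (path_image (\<gamma> e)) (p u) (p v)"
      using ends_subset_curve [OF e] uv arc_edge [OF e]
      unfolding curve_def
      by (metis arc_imp_path image_subset_iff insertCI path_connected_component path_connected_path_image)
    then have R: "?R (p u) (p v)" by (rule path_component_of_subset [rotated]) auto
    have "?R (p a) (p b)" if ab: "a \<in> V" "b \<in> V" "l' a = l' b" for a b
    proof -
      have old: "?R (p c) (p d)" if "c \<in> V" "d \<in> V" "l c = l d" for c d
        using l mono that by blast
      have to_v: "?R (p c) (p v)" if "c \<in> V" "l c = l u \<or> l c = l v" for c
        using that(2)
      proof
        assume "l c = l u"
        with old [OF that(1) uv(3)] R show ?thesis by (blast intro: path_component_trans)
      next
        assume "l c = l v"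
        with old [OF that(1) uv(4)] show ?thesis by blast
      qed
      show ?thesis
      proof (cases "l' a = l v")
        case True
        then have "l a = l u \<or> l a = l v" "l b = l u \<or> l b = l v"
          using ab(3) by (auto simp: l'_def split: if_splits)
        then show ?thesis
          using to_v ab by (blast intro: path_component_trans path_component_sym)
      next
        case False
        then have "l a = l b" using ab(3) by (auto simp: l'_def split: if_splits)
        then show ?thesis using old ab by blast
      qed
    qed
    then show ?thesis
      unfolding K' using card c F' insert(1,2) by (intro exI [of _ l'] exI [of _ F']) auto
  qed
qed

lemma faces_lower_bound:
  assumes "V \<noteq> {}"
  shows "\<exists>F. finite F \<and> F \<subseteq> components (- (p ` V \<union> drawn E)) \<and> card E + 2 \<le> card F + card V"
proof -
  obtain l :: "'a \<Rightarrow> 'a" and F where F: "finite F" "F \<subseteq> components (- (p ` V \<union> drawn E))"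
    "card E + 1 + card (l ` V) \<le> card F + card V"
    using faces_induct [OF subset_refl] by blast
  moreover have "card (l ` V) \<ge> 1"
    using assms finite_V by (simp add: Suc_le_eq card_gt_0_iff)
  ultimately show ?thesis by (intro exI [of _ F]) auto
qed

section \<open>Faces and the edges on their borders\<close>

definition faces :: "complex set set" where
  "faces = components (- (p ` V \<union> drawn E))"

text \<open>Contact at an end vertex does not count, since arbitrarily many faces can meet there.
  One point of contact in the interior of the edge suffices.\<close>

definition borders :: "complex set \<Rightarrow> 'a set set" where
  "borders F = {e \<in> E. closure F \<inter> open_curve e \<noteq> {}}"

lemma borders_subset: "borders F \<subseteq> E" by (auto simp: borders_def)

lemma faceD:
  assumes "F \<in> faces"
  shows "open F" "connected F" "F \<noteq> {}" "F \<inter> p ` V = {}" "e \<in> E \<Longrightarrow> F \<inter> curve e = {}"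
proof -
  note F = assms [unfolded faces_def]
  show "open F" using open_components [OF open_Compl [OF closed_part] F] by simp
  show "connected F" using in_components_connected [OF F] .
  show "F \<noteq> {}" using in_components_nonempty [OF F] .
  show "F \<inter> p ` V = {}" "e \<in> E \<Longrightarrow> F \<inter> curve e = {}"
    using in_components_subset [OF F] by (auto simp: drawn_def)
qed

lemma face_eqI: "F \<in> faces \<Longrightarrow> F' \<in> faces \<Longrightarrow> F \<inter> F' \<noteq> {} \<Longrightarrow> F = F'"
  unfolding faces_def using components_nonoverlap by auto

text \<open>Erasing the edges off the border does not enlarge a face. Off the vertices and the
  border, the closure of \<open>F\<close> adds nothing to \<open>F\<close>, so a larger connected
  set would be split by \<open>F\<close> and the complement of \<open>closure F\<close>.\<close>

lemma face_component_of_border: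
  assumes F: "F \<in> faces"
  shows "F \<in> components (- (p ` V \<union> drawn (borders F)))"
proof -
  let ?K = "p ` V \<union> drawn (borders F)"
  have clos: "closure F \<inter> - ?K \<subseteq> F"
  proof
    fix x assume x: "x \<in> closure F \<inter> - ?K"
    have "x \<notin> p ` V \<union> drawn E"
    proof
      assume "x \<in> p ` V \<union> drawn E"
      then obtain e where e: "e \<in> E" "x \<in> curve e" using x by (auto simp: drawn_def)
      moreover have "x \<notin> p ` e" using x edge_subset [OF e(1)] by auto
      ultimately have "e \<in> borders F" using x by (auto simp: borders_def open_curve_def)
      then show False using x e by (auto simp: drawn_def)
    qed
    moreover have "closure F \<inter> - (p ` V \<union> drawn E) \<subseteq> F"
    proof -
      obtain T where T: "closed T" "F = - (p ` V \<union> drawn E) \<inter> T"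
        using closedin_component [OF F [unfolded faces_def]] by (auto simp: closedin_closed)
      then have "closure F \<subseteq> T" by (intro closure_minimal) auto
      then show ?thesis using T(2) by auto
    qed
    ultimately show "x \<in> F" using x by blast
  qed
  have sub: "F \<subseteq> - ?K"
    using faceD(4,5) [OF F] borders_subset [of F] unfolding drawn_def by blast
  show ?thesis
    unfolding in_components_maximal
  proof (intro conjI allI impI faceD [OF F] sub)
    fix D assume D: "D \<noteq> {} \<and> F \<subseteq> D \<and> D \<subseteq> - ?K \<and> connected D"
    show "D = F"
    proof (rule ccontr)
      assume "D \<noteq> F"
      then have "D \<inter> - closure F \<noteq> {}" using D clos by blast
      moreover have "D \<subseteq> F \<union> - closure F" using D clos by blast
      ultimately show False
        using connectedD [of D F "- closure F"] D faceD [OF F] closure_subset [of F] by blast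
    qed
  qed
qed

lemma face_equals:
  assumes F: "F \<in> faces" and S: "connected S" "S \<subseteq> - (p ` V \<union> drawn (borders F))" "F \<subseteq> S"
  shows "F = S"
  using components_maximal [OF face_component_of_border [OF F] S(1,2)] S(3) faceD(3) [OF F] by blast

lemma connected_open_curve_side:
  assumes "e \<in> E" "open S" "open S'" "S \<inter> S' = {}" "open_curve e \<subseteq> S \<union> S'"
  shows "open_curve e \<subseteq> S \<or> open_curve e \<subseteq> S'"
  using connectedD [OF connected_open_curve [OF assms(1)] assms(2,3)] assms(4,5) by blast

section \<open>Triangles as Jordan curves\<close>

definition triangle :: "'a set set \<Rightarrow> bool" where
  "triangle T \<longleftrightarrow> T \<subseteq> E \<and> (\<exists>a b c. a \<noteq> b \<and> b \<noteq> c \<and> a \<noteq> c \<and> T = {{a, b}, {b, c}, {a, c}})"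

lemma card_triangle: "triangle T \<Longrightarrow> card T = 3"
proof -
  assume "triangle T"
  then obtain a b c where abc: "a \<noteq> b" "b \<noteq> c" "a \<noteq> c" "T = {{a, b}, {b, c}, {a, c}}"
    by (auto simp: triangle_def)
  then have "{a, b} \<noteq> {b, c}" "{a, b} \<noteq> {a, c}" "{b, c} \<noteq> {a, c}"
    by (simp_all add: doubleton_eq_iff)
  then show "card T = 3" using abc(4) by simp
qed

lemma triangle_pairs: "triangle T \<Longrightarrow> x \<in> \<Union> T \<Longrightarrow> y \<in> \<Union> T \<Longrightarrow> x \<noteq> y \<Longrightarrow> {x, y} \<in> T"
  unfolding triangle_def by (auto simp: insert_commute)

lemma triangle_other_edges:
  assumes "triangle T" "e \<in> T"
  obtains x y z where "e = {x, y}" "x \<noteq> y" "y \<noteq> z" "x \<noteq> z" "T = {e, {y, z}, {x, z}}"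
proof -
  obtain a b c where abc: "a \<noteq> b" "b \<noteq> c" "a \<noteq> c" "T = {{a, b}, {b, c}, {a, c}}"
    using assms by (auto simp: triangle_def)
  then consider "e = {a, b}" | "e = {b, c}" | "e = {a, c}" using assms by auto
  then show ?thesis
  proof cases
    case 1 with abc show ?thesis by (intro that [of a b c]) auto
  next
    case 2 with abc show ?thesis by (intro that [of b c a]) (auto simp: insert_commute)
  next
    case 3 with abc show ?thesis by (intro that [of a c b]) (auto simp: insert_commute)
  qed
qed

lemma arc_between:
  assumes "{u, v} \<in> E" "u \<noteq> v"
  obtains g where "arc g" "path_image g = curve {u, v}" "pathstart g = p u" "pathfinish g = p v"
proof -
  have ends: "{pathstart (\<gamma> {u, v}), pathfinish (\<gamma> {u, v})} = {p u, p v}"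
    using path_ends [OF assms(1)] by simp
  then consider "pathstart (\<gamma> {u, v}) = p u" "pathfinish (\<gamma> {u, v}) = p v"
    | "pathstart (\<gamma> {u, v}) = p v" "pathfinish (\<gamma> {u, v}) = p u"
    by (auto simp: doubleton_eq_iff)
  then show ?thesis
  proof cases
    case 1
    then show ?thesis using arc_edge [OF assms(1)] by (intro that) (auto simp: curve_def)
  next
    case 2
    then show ?thesis using arc_edge [OF assms(1)]
      by (intro that [of "reversepath (\<gamma> {u, v})"]) (auto simp: curve_def arc_reversepath)
  qed
qed

lemma edges_share:
  assumes "{a, b} \<in> E" "{b, c} \<in> E" "a \<noteq> c"
  shows "curve {a, b} \<inter> curve {b, c} = {p b}"
proof
  show "curve {a, b} \<inter> curve {b, c} \<subseteq> {p b}"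
    using curve_meet [OF assms(1,2)] assms(3) by (auto simp: doubleton_eq_iff)
  show "{p b} \<subseteq> curve {a, b} \<inter> curve {b, c}"
    using ends_subset_curve [OF assms(1)] ends_subset_curve [OF assms(2)] by auto
qed

lemma triangle_simple_path:
  assumes "triangle T"
  obtains c where "simple_path c" "pathfinish c = pathstart c" "path_image c = drawn T"
proof -
  obtain x y z where xyz: "x \<noteq> y" "y \<noteq> z" "x \<noteq> z" "T = {{x, y}, {y, z}, {x, z}}"
    and T: "{x, y} \<in> E" "{y, z} \<in> E" "{x, z} \<in> E"
    using assms by (auto simp: triangle_def)
  obtain f where f: "arc f" "path_image f = curve {x, y}" "pathstart f = p x" "pathfinish f = p y"
    using arc_between [OF T(1) xyz(1)] .
  obtain g where g: "arc g" "path_image g = curve {y, z}" "pathstart g = p y" "pathfinish g = p z"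
    using arc_between [OF T(2) xyz(2)] .
  obtain h where h: "arc h" "path_image h = curve {z, x}" "pathstart h = p z" "pathfinish h = p x"
    using arc_between [of z x] T(3) xyz(3) by (metis insert_commute)
  have meets: "curve {x, y} \<inter> curve {y, z} = {p y}" "curve {y, z} \<inter> curve {z, x} = {p z}"
    "curve {z, x} \<inter> curve {x, y} = {p x}"
    using edges_share [of x y z] edges_share [of y z x] edges_share [of z x y] T xyz
    by (auto simp: insert_commute)
  have fg: "arc (f +++ g)"
    using f g meets by (intro arc_join) auto
  have "simple_path ((f +++ g) +++ h)"
    using fg f g h meets by (intro simple_path_join_loop) (auto simp: path_image_join)
  moreover have "path_image ((f +++ g) +++ h) = drawn T"
    using f g h xyz by (auto simp: path_image_join drawn_def insert_commute)
  ultimately show ?thesis using f h by (intro that [of "(f +++ g) +++ h"]) auto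
qed

lemma triangle_inside_outside:
  assumes "triangle T"
  shows "open (inside (drawn T))" "open (outside (drawn T))"
    "connected (inside (drawn T))" "connected (outside (drawn T))"
    "inside (drawn T) \<inter> outside (drawn T) = {}"
    "inside (drawn T) \<union> outside (drawn T) = - drawn T"
proof -
  obtain c where c: "simple_path c" "pathfinish c = pathstart c" "path_image c = drawn T"
    using triangle_simple_path [OF assms] .
  show "open (inside (drawn T))" "open (outside (drawn T))"
    "connected (inside (drawn T))" "connected (outside (drawn T))"
    "inside (drawn T) \<inter> outside (drawn T) = {}"
    "inside (drawn T) \<union> outside (drawn T) = - drawn T"
    using Jordan_inside_outside [OF c(1,2)] c(3) by simp_all
qed

text \<open>The other two arcs of a triangle through \<open>e\<close> form a connected set, so by Janiszewski's
  theorem two faces at \<open>e\<close> on the same side of the triangle would be joined off the drawing.\<close>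

lemma card_faces_at_edge:
  assumes T: "triangle T" and e: "e \<in> T" and Fs: "Fs \<subseteq> {F \<in> faces. e \<in> borders F}"
  shows "card Fs \<le> 2"
proof -
  obtain S S' where S: "open S" "open S'" "connected S" "connected S'"
    "S \<inter> S' = {}" "S \<union> S' = - drawn T"
    by (rule that [OF triangle_inside_outside [OF T]])
  have eE: "e \<in> E" using T e by (auto simp: triangle_def)
  obtain x y z where xyz: "e = {x, y}" "x \<noteq> y" "y \<noteq> z" "x \<noteq> z" "T = {e, {y, z}, {x, z}}"
    using triangle_other_edges [OF T e] .
  have E': "{y, z} \<in> E" "{x, z} \<in> E" using T xyz by (auto simp: triangle_def)
  define K where "K = p ` V \<union> drawn (E - {e})"
  have K: "closed K" unfolding K_def by (rule closed_part) auto
  have Ke: "K \<union> drawn T = p ` V \<union> drawn E"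
    using T e unfolding K_def drawn_def triangle_def by blast
  have "curve e \<inter> K = p ` e" unfolding K_def using eE by (intro curve_meets_part) auto
  moreover have "curve {y, z} \<union> curve {x, z} \<subseteq> K"
    using E' xyz unfolding K_def drawn_def by (auto simp: doubleton_eq_iff)
  moreover have "p ` e \<subseteq> curve {y, z} \<union> curve {x, z}"
    using ends_subset_curve E' xyz(1) by blast
  ultimately have "drawn T \<inter> K = curve {y, z} \<union> curve {x, z}"
    using xyz(5) unfolding drawn_def by auto
  moreover have "curve {y, z} \<inter> curve {x, z} \<noteq> {}"
    using ends_subset_curve [OF E'(1)] ends_subset_curve [OF E'(2)] by auto
  ultimately have con: "connected (drawn T \<inter> K)"
    using E' by (simp add: connected_Un connected_curve)
  have com: "compact (drawn T)" using T by (intro compact_drawn) (auto simp: triangle_def)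
  have innK: "open_curve e \<subseteq> - K"
    unfolding K_def using \<open>curve e \<inter> K = p ` e\<close> by (auto simp: open_curve_def K_def)
  obtain w where w: "w \<in> open_curve e" using open_curve_nonempty [OF eE] by blast
  \<comment> \<open>With \<open>e\<close> erased, all faces at \<open>e\<close> lie in the one
    component \<open>U\<close> containing the interior of \<open>e\<close>. This provides the
    connection that avoids \<open>K\<close>; a common side of the triangle provides the one that
    avoids \<open>drawn T\<close>.\<close>
  define U where "U = connected_component_set (- K) w"
  have U: "open U" unfolding U_def using K by (intro open_connected_component) auto
  have eU: "open_curve e \<subseteq> U"
    unfolding U_def by (rule connected_component_maximal [OF w connected_open_curve [OF eE] innK])
  have FU: "F \<subseteq> U" if F: "F \<in> faces" "e \<in> borders F" for F
  proof -
    obtain a where "a \<in> closure F" "a \<in> U" using F eU by (auto simp: borders_def)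
    then obtain b where b: "b \<in> F" "b \<in> U" using U by (meson closure_iff_nhds_not_empty disjoint_iff subset_refl)
    have "F \<subseteq> - K" using in_components_subset [OF F(1) [unfolded faces_def]] Ke by auto
    then have "F \<subseteq> connected_component_set (- K) b"
      by (intro connected_component_maximal b faceD F)
    then show ?thesis using connected_component_eq [of b "- K" w] b unfolding U_def by auto
  qed
  have side: "F \<subseteq> S \<or> F \<subseteq> S'" if F: "F \<in> faces" for F
  proof -
    have "F \<subseteq> - drawn T"
      using in_components_subset [OF F [unfolded faces_def]] Ke by auto
    then show ?thesis using connectedD [OF faceD(2) [OF F] S(1,2)] S(5,6) by blast
  qed
  have same: "F = F'" if F: "F \<in> Fs" "F' \<in> Fs" and R: "R \<in> {S, S'}" "F \<subseteq> R" "F' \<subseteq> R" for F F' R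
  proof -
    have FF: "F \<in> faces" "F' \<in> faces" "F \<subseteq> U" "F' \<subseteq> U" using F Fs FU by auto
    obtain a b where ab: "a \<in> F" "b \<in> F'" using faceD(3) [OF FF(1)] faceD(3) [OF FF(2)] by auto
    have "connected R" "R \<subseteq> - drawn T" using R S by auto
    then have 1: "connected_component (- drawn T) a b"
      unfolding connected_component_def using R(2,3) ab by (intro exI [of _ R]) auto
    have "connected U" "U \<subseteq> - K" unfolding U_def by (simp_all add: connected_component_subset)
    then have 2: "connected_component (- K) a b"
      unfolding connected_component_def using FF(3,4) ab by (intro exI [of _ U]) auto
    have "connected_component (- (p ` V \<union> drawn E)) a b"
      using Janiszewski [OF com K con 1 2] Ke by (simp add: Un_commute)
    then obtain t where t: "connected t" "t \<subseteq> - (p ` V \<union> drawn E)" "a \<in> t" "b \<in> t"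
      unfolding connected_component_def by blast
    have "t \<subseteq> F" using components_maximal [OF FF(1) [unfolded faces_def] t(1,2)] t(3) ab by auto
    then show ?thesis using face_eqI [OF FF(1,2)] t(4) ab by auto
  qed
  have "inj_on (\<lambda>F. F \<subseteq> S) Fs"
  proof (rule inj_onI)
    fix F F' assume F: "F \<in> Fs" "F' \<in> Fs" "(F \<subseteq> S) = (F' \<subseteq> S)"
    then have "F \<in> faces" "F' \<in> faces" using Fs by auto
    then show "F = F'" using same [OF F(1,2)] side F(3) by blast
  qed
  then have "card Fs \<le> card (UNIV :: bool set)"
    by (intro card_inj_on_le) auto
  then show ?thesis by simp
qed

text \<open>\<open>leafy\<close> says that \<open>X\<close> is a forest, in a hereditary form that
  survives the deletion of an edge. A leaf edge meets the rest of the drawing in at most one point,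
  and an arc does not separate the plane, so Janiszewski's theorem adds the edge back.\<close>

lemma connected_Compl_leafy:
  assumes "finite X" "X \<subseteq> E"
    and leafy: "\<And>Y. Y \<subseteq> X \<Longrightarrow> Y \<noteq> {} \<Longrightarrow> \<exists>e\<in>Y. \<exists>v\<in>e. \<forall>e'\<in>Y. v \<in> e' \<longrightarrow> e' = e"
  shows "connected (- drawn X)"
  using assms
proof (induction "card X" arbitrary: X)
  case 0
  then show ?case by (simp add: drawn_def connected_UNIV)
next
  case (Suc n)
  then have "X \<noteq> {}" by auto
  from Suc.prems(3) [OF subset_refl this]
  obtain e where e: "e \<in> X" "\<exists>v\<in>e. \<forall>e'\<in>X. v \<in> e' \<longrightarrow> e' = e" by (rule bexE)
  from e(2) obtain v where "v \<in> e" "\<forall>e'\<in>X. v \<in> e' \<longrightarrow> e' = e" by (rule bexE)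
  note ev = e(1) this
  have eE: "e \<in> E" using ev(1) Suc.prems(2) by auto
  obtain u where u: "e = {u, v}"
    using edge_ends [OF eE] ev(2) by (auto simp: insert_commute)
  let ?X = "X - {e}"
  have "n = card ?X" using Suc.hyps(2) ev(1) Suc.prems(1) by simp
  then have IH: "connected (- drawn ?X)"
    using Suc.prems by (intro Suc.hyps(1)) auto
  have "curve e \<inter> curve e' \<subseteq> {p u}" if "e' \<in> ?X" for e'
  proof -
    have "e' \<in> E" "e' \<noteq> e" using that Suc.prems by auto
    then have "curve e \<inter> curve e' \<subseteq> p ` (e \<inter> e')" using curve_meet eE by blast
    moreover have "v \<notin> e'" using ev(3) that by blast
    ultimately show ?thesis using u by auto
  qed
  then have "curve e \<inter> drawn ?X \<subseteq> {p u}" by (auto simp: drawn_def)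
  then have "curve e \<inter> drawn ?X = {} \<or> curve e \<inter> drawn ?X = {p u}" by blast
  then have "connected (curve e \<inter> drawn ?X)" by auto
  moreover have "closed (drawn ?X)"
    using Suc.prems(2) by (intro compact_imp_closed compact_drawn) auto
  moreover have "connected (- curve e)"
    unfolding curve_def using arc_edge [OF eE] by (intro connected_arc_complement) auto
  ultimately have "connected (- (curve e \<union> drawn ?X))"
    using Janiszewski_connected [OF compact_curve [OF eE]] IH by blast
  moreover have "drawn X = curve e \<union> drawn ?X" using ev(1) by (auto simp: drawn_def)
  ultimately show ?case by simp
qed

lemma connected_minus_verts: "connected S \<Longrightarrow> open S \<Longrightarrow> connected (S - p ` V)"
  using finite_V by (intro connected_open_delete_finite) auto

lemma open_curve_outside_part:
  assumes "e \<in> E" "X \<subseteq> E" "e \<notin> X"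
  shows "open_curve e \<subseteq> - (p ` V \<union> drawn X)"
  using open_curve_disjoint [OF assms(1)] open_curve_no_vertex [OF assms(1)] assms(2,3)
  unfolding drawn_def by blast

lemma side_pair:
  assumes "{R, R'} = {I, J}" "open I" "open J" "connected I" "connected J" "I \<inter> J = {}" "I \<union> J = X"
  shows "open R" "open R'" "connected R" "R \<inter> R' = {}" "R \<union> R' = X"
  using assms by (auto simp: doubleton_eq_iff)

lemma face_in_side:
  assumes F: "F \<in> faces" and T: "triangle T"
  obtains "F \<subseteq> inside (drawn T)" | "F \<subseteq> outside (drawn T)"
proof -
  have "T \<subseteq> E" using T by (simp add: triangle_def)
  then have "F \<inter> drawn T = {}" using faceD(5) [OF F] unfolding drawn_def by blast
  then have "F \<subseteq> inside (drawn T) \<union> outside (drawn T)"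
    using triangle_inside_outside(6) [OF T] by blast
  then show ?thesis
    using connectedD [OF faceD(2) [OF F] triangle_inside_outside(1,2) [OF T]]
      triangle_inside_outside(5) [OF T] that by blast
qed

lemma drawn_verts:
  assumes "X \<subseteq> E" "x \<in> V" "p x \<in> drawn X"
  shows "x \<in> \<Union> X"
proof -
  obtain e where e: "e \<in> X" "p x \<in> curve e" using assms(3) by (auto simp: drawn_def)
  have eE: "e \<in> E" using e assms by auto
  then have "p x \<in> p ` e" using curve_verts [OF eE] e assms(2) by blast
  then obtain y where "y \<in> e" "p x = p y" by auto
  then have "x = y" using inj_onD [OF inj_p _ assms(2)] edge_subset [OF eE] by blast
  then show ?thesis using e \<open>y \<in> e\<close> by blast
qed

end

section \<open>Plane graphs composed of edge-disjoint triangles\<close>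

locale plane_triangles = plane_graph +
  assumes covered: "\<And>e. e \<in> E \<Longrightarrow> \<exists>T. triangle T \<and> e \<in> T"
    and edge_disjoint: "\<And>S T. triangle S \<Longrightarrow> triangle T \<Longrightarrow> S \<noteq> T \<Longrightarrow> S \<inter> T = {}"
    and no_four_cycle: "\<And>a b c d. distinct [a, b, c, d] \<Longrightarrow>
      {a, b} \<in> E \<Longrightarrow> {b, c} \<in> E \<Longrightarrow> {c, d} \<in> E \<Longrightarrow> {d, a} \<in> E \<Longrightarrow> False"
    and large: "card E > 3"
begin

text \<open>If every end of every edge met a second edge of \<open>Y\<close>, a path d, a, b, c
  could be continued to \<open>x\<close>; \<open>c = d\<close> would close a triangle. These four
  edges exhaust \<open>Y\<close>, yet \<open>d\<close> needs a second edge, so \<open>x = d\<close>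
  and a four-cycle closes.\<close>

lemma small_leafy:
  assumes X: "X \<subseteq> E" "card X \<le> 4" and no: "\<And>T. triangle T \<Longrightarrow> \<not> T \<subseteq> X"
    and Y: "Y \<subseteq> X" "Y \<noteq> {}"
  shows "\<exists>e\<in>Y. \<exists>v\<in>e. \<forall>e'\<in>Y. v \<in> e' \<longrightarrow> e' = e"
proof (rule ccontr)
  assume "\<not> ?thesis"
  then have other: "\<exists>e'\<in>Y. v \<in> e' \<and> e' \<noteq> e" if "e \<in> Y" "v \<in> e" for e v
    using that by blast
  have finX: "finite X" using X finite_subset [OF _ finite_E] by blast
  have finY: "finite Y" "card Y \<le> 4" "Y \<subseteq> E"
    using Y X finX card_mono [of X Y] finite_subset by auto
  have next_edge: "\<exists>c. {b, c} \<in> Y \<and> c \<noteq> a \<and> c \<noteq> b" if ab: "{a, b} \<in> Y" for a b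
  proof -
    obtain e' where e': "e' \<in> Y" "b \<in> e'" "e' \<noteq> {a, b}" using other [OF ab] by auto
    then obtain u v where "e' = {u, v}" "u \<noteq> v" using edge_ends finY by blast
    then show ?thesis using e' by (auto simp: insert_commute)
  qed
  obtain e where "e \<in> Y" using Y by auto
  then obtain a b where ab: "{a, b} \<in> Y" "a \<noteq> b" using edge_ends finY by blast
  obtain c where c: "{b, c} \<in> Y" "c \<noteq> a" "c \<noteq> b" using next_edge [OF ab(1)] by blast
  obtain d where d: "{a, d} \<in> Y" "d \<noteq> b" "d \<noteq> a"
    using next_edge [of b a] ab(1) by (auto simp: insert_commute)
  have "c \<noteq> d"
  proof
    assume "c = d"
    then have "triangle {{a, b}, {b, c}, {a, c}}"
      using ab c d finY unfolding triangle_def by blast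
    moreover have "{{a, b}, {b, c}, {a, c}} \<subseteq> X" using \<open>c = d\<close> ab c d Y by auto
    ultimately show False using no by blast
  qed
  obtain x where x: "{c, x} \<in> Y" "x \<noteq> b" "x \<noteq> c" using next_edge [OF c(1)] by blast
  obtain y where y: "{d, y} \<in> Y" "y \<noteq> a" "y \<noteq> d" using next_edge [OF d(1)] by blast
  have "card {{a, b}, {b, c}, {a, d}, {c, x}} = 4"
    using ab(2) c(2,3) d(2,3) x(2,3) \<open>c \<noteq> d\<close> by (simp add: doubleton_eq_iff)
  moreover have "{{a, b}, {b, c}, {a, d}, {c, x}} \<subseteq> Y" using ab c d x by auto
  ultimately have "Y = {{a, b}, {b, c}, {a, d}, {c, x}}"
    using finY by (metis card_subset_eq card_mono le_antisym)
  then have "x = d" using y(1) ab(2) c d y(2,3) \<open>c \<noteq> d\<close> by (auto simp: doubleton_eq_iff)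
  then show False
    using no_four_cycle [of a b c d] ab c d x \<open>c \<noteq> d\<close> finY by (auto simp: insert_commute)
qed

text \<open>A border without a triangle is a forest, so the face is the whole complement of its
  border and the vertices. An edge off the border would run inside the face; hence all edges, and
  with them a whole triangle, are on the border.\<close>

lemma small_border_triangle:
  assumes F: "F \<in> faces" and small: "card (borders F) \<le> 4"
  shows "\<exists>T. triangle T \<and> T \<subseteq> borders F"
proof (rule ccontr)
  assume no: "\<not> ?thesis"
  let ?X = "borders F"
  have X: "?X \<subseteq> E" "finite ?X" using borders_subset finite_subset [OF _ finite_E] by auto
  have "connected (- drawn ?X)"
    using small_leafy [OF X(1) small] no by (intro connected_Compl_leafy [OF X(2,1)]) blast
  moreover have "open (- drawn ?X)"
    using compact_drawn [OF X(1)] by (simp add: compact_imp_closed open_Compl)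
  ultimately have "connected (- drawn ?X - p ` V)" by (rule connected_minus_verts)
  moreover have eq: "- drawn ?X - p ` V = - (p ` V \<union> drawn ?X)" by auto
  ultimately have Feq: "F = - (p ` V \<union> drawn ?X)"
    using in_components_subset [OF face_component_of_border [OF F]]
    by (intro face_equals [OF F]) auto
  have "E \<subseteq> ?X"
  proof
    fix e assume e: "e \<in> E"
    show "e \<in> ?X"
    proof (rule ccontr)
      assume "e \<notin> ?X"
      then have "open_curve e \<subseteq> F" using open_curve_outside_part [OF e X(1)] Feq by auto
      then show False using faceD(5) [OF F e] open_curve_nonempty [OF e] by (auto simp: open_curve_def)
    qed
  qed
  have "E \<noteq> {}" using large by auto
  then obtain T where T: "triangle T" using covered by auto
  have "T \<subseteq> ?X" using T \<open>E \<subseteq> ?X\<close> by (auto simp: triangle_def)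
  then show False using no T by simp
qed

lemma edge_in_triangle_of_verts:
  assumes T: "triangle T" and d: "{x, y} \<in> E" "x \<noteq> y" and xy: "p x \<in> drawn T" "p y \<in> drawn T"
  shows "{x, y} \<in> T"
proof -
  have "x \<in> V" "y \<in> V" "T \<subseteq> E" using edge_subset [OF d(1)] T by (auto simp: triangle_def)
  then have "x \<in> \<Union> T" "y \<in> \<Union> T" using drawn_verts xy by blast+
  then show ?thesis using triangle_pairs [OF T] d(2) by blast
qed

text \<open>\<open>d\<close> has at most one end on \<open>T\<close>, so by Janiszewski's theorem it
  does not cut the side \<open>R\<close>, and \<open>F\<close> fills \<open>R\<close> apart from
  \<open>d\<close> and the vertices. As no edge enters \<open>F\<close>, the other two edges of the
  triangle \<open>D\<close> of \<open>d\<close> run in \<open>R'\<close>, while \<open>d\<close>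
  itself runs in \<open>R\<close>. The ends of \<open>d\<close> are thus limits of both sides and
  lie on \<open>T\<close>, which makes \<open>d\<close> an edge of \<open>T\<close>.\<close>

lemma border_not_four:
  assumes F: "F \<in> faces" and T: "triangle T" and d: "d \<in> E" "d \<notin> T" "borders F = insert d T"
    and R: "{R, R'} = {inside (drawn T), outside (drawn T)}" "F \<subseteq> R"
  shows False
proof -
  have TE: "T \<subseteq> E" using T by (simp add: triangle_def)
  have R': "open R" "open R'" "connected R" "R \<inter> R' = {}" "R \<union> R' = - drawn T"
    by (rule side_pair [OF R(1) triangle_inside_outside [OF T]])+
  obtain D where D: "triangle D" "d \<in> D" using covered [OF d(1)] by blast
  have DT: "D \<inter> T = {}" using edge_disjoint [OF D(1) T] D(2) d(2) by blast
  have DE: "D \<subseteq> E" using D(1) by (simp add: triangle_def)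
  obtain x y z where xyz: "d = {x, y}" "x \<noteq> y" "y \<noteq> z" "x \<noteq> z" "D = {d, {y, z}, {x, z}}"
    using triangle_other_edges [OF D] .
  let ?K = "drawn T \<union> curve d"
  have drawn: "drawn (borders F) = ?K" by (simp add: d(3) drawn_insert)
  have "\<not> (p x \<in> drawn T \<and> p y \<in> drawn T)"
    using edge_in_triangle_of_verts [OF T] d xyz by blast
  moreover have "drawn T \<inter> curve d \<subseteq> {p x, p y}"
    using curve_meets_part [OF d(1) TE d(2)] xyz(1) by auto
  ultimately have "drawn T \<inter> curve d = {} \<or> drawn T \<inter> curve d = {p x} \<or> drawn T \<inter> curve d = {p y}"
    by blast
  then have con: "connected (drawn T \<inter> curve d)" by auto
  have com: "compact (drawn T)" "closed (curve d)"
    using compact_drawn [OF TE] compact_curve [OF d(1)] by (auto simp: compact_imp_closed)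
  have arcc: "connected (- curve d)"
    unfolding curve_def using arc_edge [OF d(1)] by (intro connected_arc_complement) auto
  obtain a where a: "a \<in> F" using faceD(3) [OF F] by auto
  have ad: "a \<in> R" "a \<notin> curve d" using a R(2) faceD(5) [OF F d(1)] by auto
  define W where "W = connected_component_set (- ?K) a"
  have RW: "R - curve d \<subseteq> W"
  proof
    fix b assume b: "b \<in> R - curve d"
    have "R \<subseteq> - drawn T" using R'(5) by auto
    then have 1: "connected_component (- drawn T) a b"
      unfolding connected_component_def using R'(3) ad b by (intro exI [of _ R]) auto
    have 2: "connected_component (- curve d) a b"
      unfolding connected_component_def using arcc ad b by (intro exI [of _ "- curve d"]) auto
    show "b \<in> W" unfolding W_def using Janiszewski [OF com con 1 2] by simp
  qed
  have "open W"
    unfolding W_def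
    by (intro open_connected_component open_Compl closed_Un compact_imp_closed [OF com(1)] com(2))
  moreover have "connected W" unfolding W_def by simp
  ultimately have "connected (W - p ` V)" by (intro connected_minus_verts)
  moreover have "W \<subseteq> - ?K" unfolding W_def by (rule connected_component_subset)
  moreover have "F \<subseteq> R - curve d" using R(2) faceD(5) [OF F d(1)] by blast
  ultimately have "F = W - p ` V"
    using RW faceD(4) [OF F] drawn by (intro face_equals [OF F]) blast+
  then have RF: "R - curve d - p ` V \<subseteq> F" using RW by blast
  have split: "open_curve e \<subseteq> R \<or> open_curve e \<subseteq> R'" if "e \<in> E" "e \<notin> T" for e
    using open_curve_outside_part [OF that(1) TE that(2)] R'(5)
    by (intro connected_open_curve_side [OF that(1) R'(1,2,4)]) blast
  have clR: "closure R \<inter> R' = {}" "closure R' \<inter> R = {}"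
    using open_Int_closure_eq_empty [OF R'(2)] open_Int_closure_eq_empty [OF R'(1)] R'(4) by blast+
  have "closure F \<subseteq> closure R" using R(2) by (rule closure_mono)
  moreover have "closure F \<inter> open_curve d \<noteq> {}" using d(3) by (auto simp: borders_def)
  ultimately have "\<not> open_curve d \<subseteq> R'" using clR(1) by blast
  then have dR: "open_curve d \<subseteq> R" using split d by blast
  have other: "open_curve e \<subseteq> R'" if "e \<in> D" "e \<noteq> d" for e
  proof -
    have e: "e \<in> E" "e \<notin> T" using that DE DT by auto
    have "open_curve e \<inter> F = {}" using faceD(5) [OF F e(1)] by (auto simp: open_curve_def)
    moreover have "open_curve e \<inter> curve d = {}" using open_curve_disjoint [OF e(1) d(1)] that by auto
    ultimately have "open_curve e \<inter> R = {}" using RF open_curve_no_vertex [OF e(1)] by blast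
    then show ?thesis using split [OF e] open_curve_nonempty [OF e(1)] by blast
  qed
  have corner: "p w \<in> drawn T" if "w \<in> d" "w \<in> e" "e \<in> D" "e \<noteq> d" for w e
  proof -
    have eE: "e \<in> E" using that DE by auto
    have "p w \<in> closure (open_curve d)" "p w \<in> closure (open_curve e)"
      using ends_subset_curve curve_subset_closure_open_curve d(1) eE that by blast+
    then have "p w \<in> closure R" "p w \<in> closure R'"
      using closure_mono [OF dR] closure_mono [OF other [OF that(3,4)]] by auto
    then have "p w \<notin> R \<union> R'" using clR by blast
    then show ?thesis using R'(5) by blast
  qed
  have "p x \<in> drawn T" "p y \<in> drawn T"
    using corner [of x "{x, z}"] corner [of y "{y, z}"] xyz by (auto simp: doubleton_eq_iff)
  then show False using edge_in_triangle_of_verts [OF T] d xyz by blast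
qed

lemma small_border:
  assumes F: "F \<in> faces" and small: "card (borders F) \<le> 4"
  shows "triangle (borders F)"
    "F = inside (drawn (borders F)) - p ` V \<or> F = outside (drawn (borders F)) - p ` V"
proof -
  obtain T where T: "triangle T" "T \<subseteq> borders F" using small_border_triangle [OF assms] by blast
  have fin: "finite (borders F)" using borders_subset finite_subset [OF _ finite_E] by auto
  obtain R R' where R: "{R, R'} = {inside (drawn T), outside (drawn T)}" "F \<subseteq> R"
    using face_in_side [OF F T(1)] by (metis insert_commute)
  have eq: "borders F = T"
  proof (rule ccontr)
    assume "borders F \<noteq> T"
    then obtain d where d: "d \<in> borders F" "d \<notin> T" using T by blast
    have "card (insert d T) = 4"
      using card_triangle [OF T(1)] d(2) finite_subset [OF T(2) fin] by simp
    then have "borders F = insert d T"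
      using d(1) T(2) small fin by (metis card_mono card_subset_eq insert_subset le_antisym)
    then show False using border_not_four [OF F T(1) _ d(2) _ R] d(1) borders_subset by blast
  qed
  show "triangle (borders F)" using T eq by simp
  have Rside: "R = inside (drawn T) \<or> R = outside (drawn T)"
    using R(1) by (auto simp: doubleton_eq_iff)
  then have "open R" "connected R"
    using triangle_inside_outside(1-4) [OF T(1)] by auto
  moreover have "R \<subseteq> - drawn T"
    using Rside triangle_inside_outside(6) [OF T(1)] by blast
  ultimately have "F = R - p ` V"
    using connected_minus_verts [of R] R(2) faceD(4) [OF F] eq
    by (intro face_equals [OF F]) auto
  then show "F = inside (drawn (borders F)) - p ` V \<or> F = outside (drawn (borders F)) - p ` V"
    using Rside eq by auto
qed

text \<open>Two faces with the same triangle as border would fill both of its sides and leave no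
  room for another edge. A graph that is a single triangle does have two such faces;
  \<open>large\<close> excludes it.\<close>

lemma small_border_inj:
  assumes F: "F \<in> faces" "F' \<in> faces" and small: "card (borders F) \<le> 4"
    and eq: "borders F = borders F'"
  shows "F = F'"
proof (rule ccontr)
  assume ne: "F \<noteq> F'"
  define T where "T = borders F"
  have T: "triangle T" unfolding T_def by (rule small_border(1) [OF F(1) small])
  have TE: "T \<subseteq> E" using T by (simp add: triangle_def)
  define I J where "I = inside (drawn T)" and "J = outside (drawn T)"
  have "F = I - p ` V \<or> F = J - p ` V" "F' = I - p ` V \<or> F' = J - p ` V"
    using small_border(2) [OF F(1) small] small_border(2) [OF F(2)] eq small
    by (simp_all add: T_def I_def J_def)
  then have "F \<union> F' = (I \<union> J) - p ` V" using ne by blast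
  then have "F \<union> F' = - drawn T - p ` V"
    by (simp only: I_def J_def triangle_inside_outside(6) [OF T])
  have "E \<subseteq> T"
  proof
    fix e assume e: "e \<in> E"
    show "e \<in> T"
    proof (rule ccontr)
      assume "e \<notin> T"
      then have "open_curve e \<subseteq> F \<union> F'"
        using open_curve_outside_part [OF e TE] \<open>F \<union> F' = - drawn T - p ` V\<close> by blast
      then show False
        using faceD(5) [OF F(1) e] faceD(5) [OF F(2) e] open_curve_nonempty [OF e] by (auto simp: open_curve_def)
    qed
  qed
  then have "card E \<le> 3"
    using card_triangle [OF T] TE by (metis antisym order_refl)
  then show False using large by simp
qed

lemma edge_bound:
  assumes V: "V \<noteq> {}" and t: "card E = 3 * card {T. triangle T}"
  shows "7 * card {T. triangle T} + 10 \<le> 5 * card V"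
proof -
  define \<T> where "\<T> = {T. triangle T}"
  have "\<T> \<subseteq> Pow E" by (auto simp: \<T>_def triangle_def)
  then have fin\<T>: "finite \<T>" using finite_E by (meson finite_Pow_iff finite_subset)
  obtain Fs where Fs: "finite Fs" "Fs \<subseteq> faces" "card E + 2 \<le> card Fs + card V"
    using faces_lower_bound [OF V] unfolding faces_def by blast
  define S where "S = {F \<in> Fs. card (borders F) \<le> 4}"
  have finB: "finite (borders F)" for F
    using borders_subset finite_subset [OF _ finite_E] by blast
  have "inj_on borders S"
    using small_border_inj Fs(2) unfolding S_def by (intro inj_onI) blast
  moreover have "borders ` S \<subseteq> \<T>"
    using small_border(1) Fs(2) unfolding S_def \<T>_def by blast
  ultimately have cS: "card S \<le> card \<T>" using fin\<T> card_inj_on_le by blast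
  \<comment> \<open>A small face has exactly three border edges, so a bonus of 2 lifts it to 5. The
    bonus is paid at most once per triangle.\<close>
  have "5 * card Fs = (\<Sum>F\<in>Fs. 5)" by simp
  also have "\<dots> \<le> (\<Sum>F\<in>Fs. card (borders F) + (if F \<in> S then 2 else 0))"
  proof (rule sum_mono)
    fix F assume F: "F \<in> Fs"
    show "5 \<le> card (borders F) + (if F \<in> S then 2 else 0)"
    proof (cases "F \<in> S")
      case True
      then have "card (borders F) = 3"
        using small_border(1) card_triangle Fs(2) unfolding S_def by blast
      then show ?thesis using True by simp
    next
      case False
      then show ?thesis using F by (simp add: S_def)
    qed
  qed
  also have "\<dots> = (\<Sum>F\<in>Fs. card (borders F)) + 2 * card S"
  proof -
    have "Fs \<inter> S = S" by (auto simp: S_def)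
    then show ?thesis using Fs(1) by (simp add: sum.distrib sum.If_cases)
  qed
  also have "(\<Sum>F\<in>Fs. card (borders F)) = (\<Sum>F\<in>Fs. \<Sum>e\<in>E. if e \<in> borders F then 1 else 0)"
  proof (rule sum.cong)
    fix F
    have "E \<inter> borders F = borders F" using borders_subset by blast
    then show "card (borders F) = (\<Sum>e\<in>E. if e \<in> borders F then 1 else 0)"
      using finite_E by (simp flip: sum.inter_restrict)
  qed simp
  also have "\<dots> = (\<Sum>e\<in>E. \<Sum>F\<in>Fs. if e \<in> borders F then 1 else 0)" by (rule sum.swap)
  also have "\<dots> = (\<Sum>e\<in>E. card {F \<in> Fs. e \<in> borders F})"
    using Fs(1) by (simp add: sum.If_cases Collect_conj_eq)
  also have "\<dots> \<le> (\<Sum>e\<in>E. 2)"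
  proof (rule sum_mono)
    fix e assume "e \<in> E"
    then obtain T where T: "triangle T" "e \<in> T" using covered by auto
    show "card {F \<in> Fs. e \<in> borders F} \<le> 2"
      by (rule card_faces_at_edge [OF T]) (use Fs(2) in auto)
  qed
  also have "\<dots> = 2 * card E" by simp
  finally have "5 * card Fs \<le> 2 * card E + 2 * card S" by simp
  \<comment> \<open>With e = 3 t this reads 5 (3 t + 2 - n) <= 6 t + 2 t.\<close>
  then show ?thesis using cS Fs(3) t unfolding \<T>_def by simp
qed

end

section \<open>Copies of short cycles\<close>

definition triangle_on :: "'a \<Rightarrow> 'a \<Rightarrow> 'a \<Rightarrow> 'a graph" where
  "triangle_on a b c = ({a, b, c}, {{a, b}, {b, c}, {a, c}})"

lemma cycle_graph_3: "cycle_graph 3 = ({0, 1, 2}, {{0, 1}, {1, 2}, {2, 0}})"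
proof -
  have "{..<3} = {0, 1, 2::nat}" by auto
  moreover have "(0 + 1) mod 3 = (1::nat)" "(1 + 1) mod 3 = (2::nat)" "(2 + 1) mod 3 = (0::nat)"
    by simp_all
  ultimately show ?thesis by (simp only: cycle_graph_def image_insert image_empty)
qed

lemma cycle_graph_4: "cycle_graph 4 = ({0, 1, 2, 3}, {{0, 1}, {1, 2}, {2, 3}, {3, 0}})"
proof -
  have "{..<4} = {0, 1, 2, 3::nat}" by auto
  moreover have "(0 + 1) mod 4 = (1::nat)" "(1 + 1) mod 4 = (2::nat)" "(2 + 1) mod 4 = (3::nat)"
    "(3 + 1) mod 4 = (0::nat)" by simp_all
  ultimately show ?thesis by (simp only: cycle_graph_def image_insert image_empty)
qed

text \<open>Copies are subgraphs, not embeddings: the six orderings of \<open>a\<close>,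
  \<open>b\<close>, \<open>c\<close> describe one copy.\<close>

lemma copies_cycle_3:
  "copies (cycle_graph 3) G = {triangle_on a b c | a b c. distinct [a, b, c] \<and>
     {a, b, c} \<subseteq> verts G \<and> {{a, b}, {b, c}, {a, c}} \<subseteq> edges G}" (is "?L = ?R")
proof
  show "?L \<subseteq> ?R"
  proof
    fix H assume "H \<in> ?L"
    then have sub: "verts H \<subseteq> verts G" "edges H \<subseteq> edges G" and "graph_iso (cycle_graph 3) H"
      by (auto simp: copies_def is_subgraph_def)
    then obtain f where f: "bij_betw f {0, 1, 2::nat} (verts H)"
      "edges H = (\<lambda>e. f ` e) ` {{0, 1}, {1, 2}, {2, 0}}"
      unfolding graph_iso_def cycle_graph_3 by auto
    have "distinct [f 0, f 1, f 2]"
      using bij_betw_imp_inj_on [OF f(1)] by (auto simp: inj_on_def)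
    moreover have "verts H = {f 0, f 1, f 2}" using bij_betw_imp_surj_on [OF f(1)] by auto
    moreover have "edges H = {{f 0, f 1}, {f 1, f 2}, {f 0, f 2}}"
      by (simp only: f(2) image_insert image_empty insert_commute [of "f 2" "f 0"])
    moreover have "H = (verts H, edges H)" by simp
    ultimately show "H \<in> ?R"
      unfolding triangle_on_def using sub by (intro CollectI exI [of _ "f 0"] exI [of _ "f 1"] exI [of _ "f 2"]) auto
  qed
  show "?R \<subseteq> ?L"
  proof
    fix H assume "H \<in> ?R"
    then obtain a b c where H: "H = triangle_on a b c" "distinct [a, b, c]"
      "{a, b, c} \<subseteq> verts G" "{{a, b}, {b, c}, {a, c}} \<subseteq> edges G" by blast
    define f where "f i = (if i = 0 then a else if i = 1 then b else c)" for i :: nat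
    have "bij_betw f {0, 1, 2} {a, b, c}"
      using H(2) by (auto simp: bij_betw_def inj_on_def f_def)
    moreover have "f 0 = a" "f 1 = b" "f 2 = c" by (simp_all add: f_def)
    then have "{{a, b}, {b, c}, {a, c}} = (\<lambda>e. f ` e) ` {{0, 1}, {1, 2}, {2, 0}}"
      by (simp only: image_insert image_empty insert_commute [of c a])
    ultimately have "graph_iso (cycle_graph 3) H"
      unfolding graph_iso_def cycle_graph_3 H(1) triangle_on_def by auto
    moreover have "simple_graph H"
      using H(2) by (auto simp: H(1) triangle_on_def simple_graph_def)
    ultimately show "H \<in> ?L"
      using H(3,4) by (auto simp: copies_def is_subgraph_def H(1) triangle_on_def)
  qed
qed

lemma contains_cycle_4:
  "contains_copy G (cycle_graph 4) \<longleftrightarrow> (\<exists>a b c d. distinct [a, b, c, d] \<and>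
     {a, b, c, d} \<subseteq> verts G \<and> {{a, b}, {b, c}, {c, d}, {d, a}} \<subseteq> edges G)" (is "?L = ?R")
proof
  assume ?L
  then obtain H where "H \<in> copies (cycle_graph 4) G" unfolding contains_copy_def by blast
  then have sub: "verts H \<subseteq> verts G" "edges H \<subseteq> edges G" and "graph_iso (cycle_graph 4) H"
    by (auto simp: copies_def is_subgraph_def)
  then obtain f where f: "bij_betw f {0, 1, 2, 3::nat} (verts H)"
    "edges H = (\<lambda>e. f ` e) ` {{0, 1}, {1, 2}, {2, 3}, {3, 0}}"
    unfolding graph_iso_def cycle_graph_4 by auto
  have "distinct [f 0, f 1, f 2, f 3]"
    using bij_betw_imp_inj_on [OF f(1)] by (auto simp: inj_on_def)
  moreover have "verts H = {f 0, f 1, f 2, f 3}" using bij_betw_imp_surj_on [OF f(1)] by auto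
  moreover have "edges H = {{f 0, f 1}, {f 1, f 2}, {f 2, f 3}, {f 3, f 0}}"
    by (simp only: f(2) image_insert image_empty)
  ultimately show ?R
    using sub
    by (intro exI [of _ "f 0"] exI [of _ "f 1"] exI [of _ "f 2"] exI [of _ "f 3"] conjI) simp_all
next
  assume ?R
  then obtain a b c d where abcd: "distinct [a, b, c, d]" "{a, b, c, d} \<subseteq> verts G"
    "{{a, b}, {b, c}, {c, d}, {d, a}} \<subseteq> edges G" by (elim exE conjE) (rule that)
  let ?H = "({a, b, c, d}, {{a, b}, {b, c}, {c, d}, {d, a}})"
  define f where "f i = (if i = 0 then a else if i = 1 then b else if i = 2 then c else d)" for i :: nat
  have "bij_betw f {0, 1, 2, 3} {a, b, c, d}"
    using abcd(1) by (auto simp: bij_betw_def inj_on_def f_def)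
  moreover have "f 0 = a" "f 1 = b" "f 2 = c" "f 3 = d" by (simp_all add: f_def)
  then have "{{a, b}, {b, c}, {c, d}, {d, a}} = (\<lambda>e. f ` e) ` {{0, 1}, {1, 2}, {2, 3}, {3, 0}}"
    by (simp only: image_insert image_empty)
  ultimately have "graph_iso (cycle_graph 4) ?H"
    unfolding graph_iso_def cycle_graph_4 by auto
  moreover have "simple_graph ?H" using abcd(1) by (auto simp: simple_graph_def)
  ultimately have "?H \<in> copies (cycle_graph 4) G"
    using abcd by (simp add: copies_def is_subgraph_def)
  then show ?L unfolding contains_copy_def by blast
qed

lemma finite_copies: "simple_graph G \<Longrightarrow> finite (copies H G)"
proof -
  assume G: "simple_graph G"
  then have "finite (verts G)" "edges G \<subseteq> Pow (verts G)" by (auto simp: simple_graph_def)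
  then have "finite (Pow (verts G) \<times> Pow (edges G))" by (meson finite_Pow_iff finite_SigmaI finite_subset)
  moreover have "copies H G \<subseteq> Pow (verts G) \<times> Pow (edges G)"
    by (auto simp: copies_def is_subgraph_def)
  ultimately show ?thesis by (rule finite_subset [rotated])
qed

lemma copies_bound:
  fixes G :: "'a graph"
  assumes G: "simple_graph G" "planar G" "\<not> contains_copy G (cycle_graph 4)" and n: "4 \<le> card (verts G)"
  shows "7 * card (copies (cycle_graph 3) G) + 10 \<le> 5 * card (verts G)"
proof (cases "card (copies (cycle_graph 3) G) \<le> 1")
  \<comment> \<open>With at most one copy, 7 + 10 <= 5 n is enough; this holds from n = 4 on and
    fails for a single triangle with n = 3.\<close>
  case True
  then show ?thesis using n by simp
next
  case False
  let ?C = "copies (cycle_graph 3) G"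
  define V where "V = verts G"
  define \<T> where "\<T> = edges ` ?C"
  \<comment> \<open>All vertices are kept and only edges outside triangles are dropped, so neither n
    nor the number of triangles changes.\<close>
  define E where "E = \<Union> \<T>"
  have G_edges: "e \<subseteq> V" "card e = 2" if "e \<in> edges G" for e
    using G(1) that by (auto simp: simple_graph_def V_def)
  have \<T>_iff: "T \<in> \<T> \<longleftrightarrow> (\<exists>a b c. distinct [a, b, c] \<and> T \<subseteq> edges G \<and> T = {{a, b}, {b, c}, {a, c}})"
    (is "_ \<longleftrightarrow> ?P") for T
  proof
    assume "T \<in> \<T>"
    then obtain a b c where "distinct [a, b, c]" "{{a, b}, {b, c}, {a, c}} \<subseteq> edges G"
      "T = edges (triangle_on a b c)" unfolding \<T>_def copies_cycle_3 by blast
    then show ?P unfolding triangle_on_def snd_conv by blast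
  next
    assume ?P
    then obtain a b c where abc: "distinct [a, b, c]" "T \<subseteq> edges G" "T = {{a, b}, {b, c}, {a, c}}" by blast
    then have "{a, b, c} \<subseteq> verts G" using G_edges(1) unfolding V_def by blast
    then have "triangle_on a b c \<in> ?C" unfolding copies_cycle_3 using abc by blast
    moreover have "T = edges (triangle_on a b c)" by (simp add: triangle_on_def abc(3))
    ultimately show "T \<in> \<T>" unfolding \<T>_def by (rule image_eqI [rotated])
  qed
  \<comment> \<open>A triangle has no isolated vertices, so a copy is determined by its
    edges.\<close>
  have "verts H = \<Union> (edges H)" if "H \<in> ?C" for H
    using that unfolding copies_cycle_3 triangle_on_def by auto
  then have "inj_on edges ?C" by (metis inj_onI prod.expand)
  then have card\<T>: "card \<T> = card ?C" unfolding \<T>_def by (rule card_image)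
  have EG: "E \<subseteq> edges G" unfolding E_def using \<T>_iff by blast
  have four: False if "distinct [a, b, c, d]" "{a, b} \<in> edges G" "{b, c} \<in> edges G"
    "{c, d} \<in> edges G" "{d, a} \<in> edges G" for a b c d
  proof -
    have "{a, b, c, d} \<subseteq> verts G" using G_edges(1) that unfolding V_def by blast
    then show False using G(3) that unfolding contains_cycle_4 by blast
  qed
  obtain p \<gamma> where d: "plane_drawing G p \<gamma>" using G(2) by (auto simp: planar_def)
  interpret plane_graph V E p \<gamma>
  proof
    show "simple_graph (V, E)"
      using G(1) EG by (auto simp: simple_graph_def V_def)
    show "plane_drawing (V, E) p \<gamma>"
      using d EG by (simp add: plane_drawing_def V_def subset_iff)
  qed
  have tri: "triangle T \<longleftrightarrow> T \<in> \<T>" for T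
  proof
    assume "triangle T"
    then obtain a b c where abc: "T \<subseteq> E" "a \<noteq> b" "b \<noteq> c" "a \<noteq> c" "T = {{a, b}, {b, c}, {a, c}}"
      unfolding triangle_def by (elim conjE exE) (rule that)
    show "T \<in> \<T>" unfolding \<T>_iff
      using abc(1) EG by (intro exI [of _ a] exI [of _ b] exI [of _ c] conjI abc(5)) (auto simp: abc(2-4))
  next
    assume T: "T \<in> \<T>"
    then have "T \<subseteq> E" unfolding E_def by blast
    then show "triangle T" using T unfolding triangle_def \<T>_iff by auto
  qed
  have disj: "S \<inter> T = {}" if S: "S \<in> \<T>" and T: "T \<in> \<T>" and ne: "S \<noteq> T" for S T
  proof (rule ccontr)
    assume "S \<inter> T \<noteq> {}"
    then obtain e where e: "e \<in> S" "e \<in> T" by blast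
    obtain x y z where x: "e = {x, y}" "x \<noteq> y" "y \<noteq> z" "x \<noteq> z" "S = {e, {y, z}, {x, z}}"
      using triangle_other_edges [of S e] S e tri by metis
    obtain x' y' w where x': "e = {x', y'}" "x' \<noteq> y'" "y' \<noteq> w" "x' \<noteq> w" "T = {e, {y', w}, {x', w}}"
      using triangle_other_edges [of T e] T e tri by metis
    have T': "T = {e, {y, w}, {x, w}}" "w \<noteq> x" "w \<noteq> y"
      using x(1,2) x' by (auto simp: doubleton_eq_iff)
    have "w \<noteq> z" using ne x(5) T' by auto
    moreover have "S \<subseteq> edges G" "T \<subseteq> edges G" using S T \<T>_iff by blast+
    \<comment> \<open>The common edge is a diagonal of the four-cycle through the two apexes
      \<open>z\<close> and \<open>w\<close>.\<close>
    ultimately show False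
      using four [of x z y w] x(2-5) T' by (auto simp: insert_commute)
  qed
  have card3: "card T = 3" if "T \<in> \<T>" for T using card_triangle tri that by blast
  have fin: "finite \<T>" unfolding \<T>_def using finite_copies [OF G(1)] by blast
  have "card E = (\<Sum>T\<in>\<T>. card T)"
    unfolding E_def using disj card3
    by (intro card_Union_disjoint) (auto simp: pairwise_def disjnt_def intro: card_ge_0_finite)
  then have cE: "card E = 3 * card \<T>" using card3 by simp
  have eq: "{T. triangle T} = \<T>" using tri by auto
  interpret plane_triangles V E p \<gamma>
  proof
    show "\<exists>T. triangle T \<and> e \<in> T" if "e \<in> E" for e
      using that tri unfolding E_def by blast
    show "S \<inter> T = {}" if "triangle S" "triangle T" "S \<noteq> T" for S T
      using disj tri that by blast
    show False if "distinct [a, b, c, d]" "{a, b} \<in> E" "{b, c} \<in> E" "{c, d} \<in> E" "{d, a} \<in> E" for a b c d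
      using four that EG by blast
    show "card E > 3" using cE card\<T> False by simp
  qed
  have "V \<noteq> {}" using n by (auto simp: V_def)
  from edge_bound [OF this] have "7 * card \<T> + 10 \<le> 5 * card V"
    by (simp add: eq cE)
  then show ?thesis by (simp add: card\<T> V_def)
qed

section \<open>Integer segments\<close>

type_synonym point = "int \<times> int"

text \<open>Twice the signed area of the triangle with these corners; the sign tells on which side
  of the line through the first two points the third one lies.\<close>

fun orient :: "point \<Rightarrow> point \<Rightarrow> point \<Rightarrow> int" where
  "orient (a, b) (c, d) (e, f) = (c - a) * (f - b) - (d - b) * (e - a)"

lemma orient_def:
  "orient a b c = (fst b - fst a) * (snd c - snd a) - (snd b - snd a) * (fst c - fst a)"
  by (cases a; cases b; cases c) simp

definition separated :: "point \<Rightarrow> point \<Rightarrow> point \<Rightarrow> point \<Rightarrow> bool" where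
  "separated a b c d \<longleftrightarrow>
     orient a b c * orient a b d > 0 \<or> orient c d a * orient c d b > 0"

text \<open>Two segments from \<open>a\<close> overlap only along a common ray. A non-zero cross
  product or a negative inner product rules that out.\<close>

definition diverging :: "point \<Rightarrow> point \<Rightarrow> point \<Rightarrow> bool" where
  "diverging a u w \<longleftrightarrow> orient a u w \<noteq> 0 \<or>
     (fst u - fst a) * (fst w - fst a) + (snd u - snd a) * (snd w - snd a) < 0"

definition emb :: "point \<Rightarrow> complex" where
  "emb z = Complex (of_int (fst z)) (of_int (snd z))"

lemma emb_simps [simp]: "Re (emb z) = of_int (fst z)" "Im (emb z) = of_int (snd z)"
  by (simp_all add: emb_def)

lemma affine_sign:
  fixes l :: "complex \<Rightarrow> real"
  assumes l: "\<And>u. l ((1 - u) *\<^sub>R c + u *\<^sub>R d) = (1 - u) * l c + u * l d"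
    and z: "z \<in> closed_segment c d" and pos: "l c * l d > 0"
  shows "l z \<noteq> 0"
proof -
  obtain u where u: "0 \<le> u" "u \<le> 1" and z: "z = (1 - u) *\<^sub>R c + u *\<^sub>R d"
    using z by (auto simp: closed_segment_def)
  have "l z * l c = (1 - u) * (l c)\<^sup>2 + u * (l c * l d)"
    unfolding z l by (simp add: algebra_simps power2_eq_square)
  also have "\<dots> > 0"
  proof (cases "u = 0")
    case True
    then show ?thesis using pos by (auto simp: zero_less_mult_iff)
  next
    case False
    then have "u * (l c * l d) > 0" using u pos by (metis less_eq_real_def mult_pos_pos)
    moreover have "(1 - u) * (l c)\<^sup>2 \<ge> 0" using u by simp
    ultimately show ?thesis by linarith
  qed
  finally show ?thesis by auto
qed

definition side :: "complex \<Rightarrow> complex \<Rightarrow> complex \<Rightarrow> real" where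
  "side a b z = (Re b - Re a) * (Im z - Im a) - (Im b - Im a) * (Re z - Re a)"

lemma side_affine: "side a b ((1 - u) *\<^sub>R c + u *\<^sub>R d) = (1 - u) * side a b c + u * side a b d"
  by (simp add: side_def algebra_simps)

lemma side_on_segment:
  assumes "z \<in> closed_segment a b"
  shows "side a b z = 0"
proof -
  obtain u where "z = (1 - u) *\<^sub>R a + u *\<^sub>R b"
    using assms by (auto simp: closed_segment_def)
  then have "side a b z = (1 - u) * side a b a + u * side a b b"
    by (simp only: side_affine)
  then show ?thesis by (simp add: side_def)
qed

lemma side_emb: "side (emb a) (emb b) (emb c) = of_int (orient a b c)"
  by (simp add: side_def orient_def)

lemma separated_half:
  assumes "orient a b c * orient a b d > 0"
  shows "closed_segment (emb a) (emb b) \<inter> closed_segment (emb c) (emb d) = {}"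
proof -
  have "side (emb a) (emb b) (emb c) * side (emb a) (emb b) (emb d) > 0"
    unfolding side_emb of_int_mult [symmetric] of_int_0_less_iff using assms .
  then show ?thesis
    using affine_sign [of "side (emb a) (emb b)", OF side_affine] side_on_segment by blast
qed

lemma separated_segments:
  assumes "separated a b c d"
  shows "closed_segment (emb a) (emb b) \<inter> closed_segment (emb c) (emb d) = {}"
  using assms separated_half [of a b c d] separated_half [of c d a b]
  unfolding separated_def by blast

lemma diverging_segments:
  assumes "diverging a u w"
  shows "closed_segment (emb a) (emb u) \<inter> closed_segment (emb a) (emb w) \<subseteq> {emb a}"
proof
  fix z assume "z \<in> closed_segment (emb a) (emb u) \<inter> closed_segment (emb a) (emb w)"
  then obtain s t where s: "0 \<le> s" "z = (1 - s) *\<^sub>R emb a + s *\<^sub>R emb u"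
    and t: "0 \<le> t" "z = (1 - t) *\<^sub>R emb a + t *\<^sub>R emb w"
    by (auto simp: closed_segment_def)
  define U where "U = emb u - emb a"
  define W where "W = emb w - emb a"
  have zs: "z - emb a = s *\<^sub>R U" and zt: "z - emb a = t *\<^sub>R W"
    by (simp add: s(2) U_def algebra_simps, simp add: t(2) W_def algebra_simps)
  show "z \<in> {emb a}"
  proof (rule ccontr)
    assume "z \<notin> {emb a}"
    then have "s \<noteq> 0" "t \<noteq> 0" using zs zt by auto
    have re: "s * Re U = t * Re W" and im: "s * Im U = t * Im W"
      using zs zt by (metis scaleR_complex.simps)+
    have "(s * t) * (Re U * Im W - Im U * Re W) = (s * Re U) * (t * Im W) - (s * Im U) * (t * Re W)"
      by (simp add: algebra_simps)
    also have "\<dots> = 0" unfolding re im by simp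
    finally have o0: "Re U * Im W - Im U * Re W = 0" using \<open>s \<noteq> 0\<close> \<open>t \<noteq> 0\<close> by simp
    have "s * (Re U * Re W + Im U * Im W) = (s * Re U) * Re W + (s * Im U) * Im W"
      by (simp add: algebra_simps)
    also have "\<dots> = t * ((Re W)\<^sup>2 + (Im W)\<^sup>2)"
      unfolding re im by (simp add: algebra_simps power2_eq_square)
    also have "\<dots> \<ge> 0" using t(1) by simp
    finally have d0: "Re U * Re W + Im U * Im W \<ge> 0"
      using s(1) \<open>s \<noteq> 0\<close> by (simp add: zero_le_mult_iff)
    have "of_int (orient a u w) = Re U * Im W - Im U * Re W"
      by (simp add: orient_def U_def W_def)
    moreover have "of_int ((fst u - fst a) * (fst w - fst a) + (snd u - snd a) * (snd w - snd a))
        = Re U * Re W + Im U * Im W"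
      by (simp add: U_def W_def)
    ultimately show False
      using assms o0 d0 unfolding diverging_def
      by (metis of_int_eq_0_iff of_int_0_le_iff not_le)
  qed
qed

text \<open>The \<open>g\<close>-th part of a spiral graph joins ring \<open>g - 1\<close>, whose vertices have the codes 0 to 13 in
  that part, to ring \<open>g\<close>, with codes 14 to 27. The innermost part has the centre, code 13, in
  place of ring \<open>g - 1\<close>, and the outermost part has one more vertex, code 28. Triples are
  increasing.\<close>

datatype part = Inner | Middle | Outer

fun triangles :: "part \<Rightarrow> (nat \<times> nat \<times> nat) list" where
  "triangles Inner = [(13, 21, 22), (13, 14, 15), (22, 23, 24), (15, 16, 17), (24, 25, 26),
     (17, 18, 19), (14, 26, 27), (19, 20, 21)]"
| "triangles Middle = [(6, 24, 25), (13, 17, 18), (4, 21, 22), (11, 14, 15), (2, 18, 19),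
     (9, 25, 26), (22, 23, 24), (15, 16, 17), (14, 26, 27), (19, 20, 21)]"
| "triangles Outer = [(6, 24, 25), (13, 17, 18), (4, 21, 22), (11, 14, 15), (2, 18, 19),
     (9, 25, 26), (22, 23, 24), (15, 16, 17), (14, 26, 27), (19, 20, 21), (16, 20, 28), (23, 27, 28)]"

text \<open>The coordinates come from a numerical search, starting from a barycentric drawing of the
  strip. Ring \<open>g\<close> scaled to part \<open>g + 1\<close> is \<open>low_ring\<close>; the last ring is deformed to
  let the extra vertex be joined by straight segments.\<close>

definition low_ring :: "point list" where
  "low_ring = [(3, -1), (3, 1), (2, 3), (1, 2), (0, 3), (-1, 2), (-2, 3), (-3, 1), (-3, -1), (-2, -3),
     (-1, -2), (0, -3), (1, -2), (2, -3)]"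

definition base_ring :: "point list" where
  "base_ring = [(-2, -6), (2, -6), (6, -4), (4, -2), (6, 0), (4, 2), (6, 4), (2, 6), (-2, 6), (-6, 4),
     (-4, 2), (-6, 0), (-4, -2), (-6, -4)]"

definition last_ring :: "point list" where
  "last_ring = [(2, -6), (2, -5), (7, 0), (4, -2), (5, -1), (5, 2), (8, 0), (5, 8), (-6, 6), (-8, -4),
     (-6, 4), (-5, -2), (-6, -2), (-7, -4), (2, -7)]"

text \<open>The entries \<open>(0, 0)\<close> let codes serve as list indices; the only one of them
  that occurs in a link is the centre, code 13.\<close>

fun points :: "part \<Rightarrow> point list" where
  "points Inner = replicate 14 (0, 0) @ base_ring"
| "points Middle = low_ring @ base_ring"
| "points Outer = low_ring @ last_ring"

definition links :: "part \<Rightarrow> (nat \<times> nat) list" where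
  "links k = concat (map (\<lambda>(a, b, c). [(a, b), (a, c), (b, c)]) (triangles k))"

type_synonym segment = "(int \<times> point) \<times> (int \<times> point)"

definition segments :: "part \<Rightarrow> segment list" where
  "segments k = map (\<lambda>(a, b). ((int a, points k ! a), (int b, points k ! b))) (links k)"

text \<open>Multiplication by -2i. The links between two rings advance by 2 to 5 of the 14 places,
  on average by 3.5, a quarter of the ring. The rings are listed counterclockwise, so the clockwise
  quarter turn cancels this advance and one table fits all bands.\<close>

fun stretch :: "point \<Rightarrow> point" where
  "stretch (x, y) = (2 * y, - 2 * x)"

fun shift_segment :: "segment \<Rightarrow> segment" where
  "shift_segment ((a, p), (b, q)) = ((a + 14, stretch p), (b + 14, stretch q))"

text \<open>Shared ends are recognised by their codes, and the segments are then compared as seen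
  from the shared end. The alternative \<open>b = d\<close> admits an edge compared with itself, as
  each part is tested against itself.\<close>

fun compatible :: "segment \<Rightarrow> segment \<Rightarrow> bool" where
  "compatible ((a, p), (b, q)) ((c, r), (d, s)) \<longleftrightarrow>
     (if a = c then b = d \<or> diverging p q s
      else if a = d then diverging p q r
      else if b = c then diverging q p s
      else if b = d then diverging q p r
      else separated p q r s)"

definition all_compatible :: "segment list \<Rightarrow> segment list \<Rightarrow> bool" where
  "all_compatible es fs \<longleftrightarrow> list_all (\<lambda>e. list_all (compatible e) fs) es"

lemma compatible_parts:
  "all_compatible (segments Inner) (segments Inner)"
  "all_compatible (segments Middle) (segments Middle)"
  "all_compatible (segments Outer) (segments Outer)"
  by code_simp+

text \<open>\<open>Inner\<close> never meets \<open>Outer\<close> directly once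
  \<open>2 \<le> M\<close>, which is the range of the planarity proof.\<close>

lemma compatible_neighbours:
  "all_compatible (segments Inner) (map shift_segment (segments Middle))"
  "all_compatible (segments Middle) (map shift_segment (segments Middle))"
  "all_compatible (segments Middle) (map shift_segment (segments Outer))"
  by code_simp+

text \<open>Both ends lie strictly beyond one of eight lines around the square of radius \<open>3/2\<close>. In the
  coordinates of a part, that square contains all parts at least two steps further in.\<close>

fun clear_of_box :: "segment \<Rightarrow> bool" where
  "clear_of_box ((a, (x, y)), (b, (u, v))) \<longleftrightarrow>
     list_ex (\<lambda>(r, s). 2 * (r * x + s * y) > 3 * (\<bar>r\<bar> + \<bar>s\<bar>) \<and> 2 * (r * u + s * v) > 3 * (\<bar>r\<bar> + \<bar>s\<bar>))
       [(1, 0), (-1, 0), (0, 1), (0, -1), (1, 1), (1, -1), (-1, 1), (-1, -1)]"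

lemma clear_parts:
  "list_all clear_of_box (segments Middle)" "list_all clear_of_box (segments Outer)"
  by code_simp+

section \<open>A finite test for four-cycles\<close>

type_synonym link = "int \<times> int"

definition offset :: "int \<Rightarrow> part \<Rightarrow> link list" where
  "offset d k = map (\<lambda>(a, b). (int a + d, int b + d)) (links k)"

definition neighbours :: "link list \<Rightarrow> int \<Rightarrow> int list" where
  "neighbours es v = map snd (filter (\<lambda>e. fst e = v) es) @ map fst (filter (\<lambda>e. snd e = v) es)"

text \<open>Multiplicities are kept: an end reached through two different neighbours is the opposite
  corner of a four-cycle through \<open>v\<close>. Walks back to \<open>v\<close> are
  discarded.\<close>

definition two_steps :: "link list \<Rightarrow> int \<Rightarrow> int list" where
  "two_steps es v = filter (\<lambda>z. z \<noteq> v) (concat (map (neighbours es) (neighbours es v)))"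

definition uniquely_linked :: "link list \<Rightarrow> int list \<Rightarrow> bool" where
  "uniquely_linked es vs \<longleftrightarrow> list_all (\<lambda>v. distinct (two_steps es v)) vs"

definition window :: "part \<Rightarrow> part \<Rightarrow> part \<Rightarrow> link list" where
  "window k l m = offset 0 k @ offset 14 l @ offset 28 m"

text \<open>Codes 14 to 27 suffice when the cycle has an edge in the first part of the window. The
  last window must also serve cycles that start later, so it is tested up to the extra vertex, code
  28 + 28 = 56.\<close>

lemma uniquely_linked_windows:
  "uniquely_linked (window Inner Middle Middle) [14..27]"
  "uniquely_linked (window Middle Middle Middle) [14..27]"
  "uniquely_linked (window Middle Middle Outer) [14..56]"
  by code_simp+

section \<open>The spiral graphs\<close>

definition part_of :: "nat \<Rightarrow> nat \<Rightarrow> part" where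
  "part_of M g = (if g = 0 then Inner else if g < M then Middle else Outer)"

text \<open>Code \<open>c\<close> of part \<open>g\<close> is the vertex \<open>14 g + c\<close>, so the numbering starts at the centre, 13.\<close>

definition spiral_verts :: "nat \<Rightarrow> nat set" where
  "spiral_verts M = {13..14 * (M + 2)}"

definition spiral_edges :: "nat \<Rightarrow> nat set set" where
  "spiral_edges M = {{14 * g + a, 14 * g + b} | g a b. g \<le> M \<and> (a, b) \<in> set (links (part_of M g))}"

abbreviation spiral :: "nat \<Rightarrow> nat graph" where
  "spiral M \<equiv> (spiral_verts M, spiral_edges M)"

definition turn :: complex where "turn = - 2 * \<i>"

text \<open>The vertices 14 g + 14 to 14 g + 27 form ring \<open>g\<close>, hence
  \<open>v div 14 - 1\<close>. Truncated subtraction sends the centre 13 to part 0, and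
  \<open>min\<close> sends the extra vertex 14 (M + 2) to part \<open>M\<close>.\<close>

definition pos :: "nat \<Rightarrow> nat \<Rightarrow> complex" where
  "pos M v = (let g = min M (v div 14 - 1) in
     turn ^ g * emb (points (part_of M g) ! (v - 14 * g)))"

lemma links_bounds:
  assumes "(a, b) \<in> set (links k)"
  shows "a < b" "14 \<le> b" "b \<le> 28" "a < 28" "k \<noteq> Outer \<Longrightarrow> b < 28" "k = Inner \<Longrightarrow> 13 \<le> a"
  using assms by (cases k; auto simp: links_def)+

lemma links_cover:
  assumes "14 \<le> c" "c < 28"
  shows "\<exists>d. (c, d) \<in> set (links k) \<or> (d, c) \<in> set (links k)"
proof -
  have "list_all (\<lambda>c. list_ex (\<lambda>(a, b). a = c \<or> b = c) (links k)) [14..<28]"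
    by (induct k; code_simp)
  moreover have "c \<in> set [14..<28]" using assms by (simp only: set_upt atLeastLessThan_iff simp_thms)
  ultimately have "list_ex (\<lambda>(a, b). a = c \<or> b = c) (links k)"
    unfolding list_all_iff by (rule bspec)
  then show ?thesis unfolding list_ex_iff by blast
qed

lemma low_ring_stretch: "c < 14 \<Longrightarrow> base_ring ! c = stretch (low_ring ! c)"
proof -
  have "list_all (\<lambda>c. base_ring ! c = stretch (low_ring ! c)) [0..<14]" by code_simp
  then show "c < 14 \<Longrightarrow> base_ring ! c = stretch (low_ring ! c)" by (simp add: list_all_iff)
qed

lemma emb_stretch: "emb (stretch z) = turn * emb z"
  by (cases z) (simp add: complex_eq_iff turn_def)

lemma emb_inject: "emb x = emb y \<longleftrightarrow> x = y"
  by (cases x; cases y) (simp add: emb_def)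

text \<open>A vertex on a ring between two parts has a code in each. Both give the same position
  because \<open>base_ring\<close> is \<open>low_ring\<close> stretched, which absorbs one factor
  \<open>turn\<close>.\<close>

lemma pos_code:
  assumes g: "g \<le> M" and M: "1 \<le> M" and c: "c < 28 \<or> c = 28 \<and> g = M" and low: "g = 0 \<Longrightarrow> 13 \<le> c"
  shows "pos M (14 * g + c) = turn ^ g * emb (points (part_of M g) ! c)"
proof (cases "14 \<le> c")
  case True
  then have "min M ((14 * g + c) div 14 - 1) = g" using g c by auto
  then show ?thesis by (simp add: pos_def)
next
  case False
  show ?thesis
  proof (cases g)
    case 0
    then have "c = 13" using low False by simp
    then show ?thesis using 0 M by (simp add: pos_def)
  next
    case (Suc h)
    have h: "min M ((14 * g + c) div 14 - 1) = h" using Suc False g by auto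
    have "part_of M h \<in> {Inner, Middle}" "part_of M g \<in> {Middle, Outer}"
      using Suc g by (auto simp: part_of_def)
    moreover have "length low_ring = 14" by (simp add: low_ring_def)
    ultimately have "points (part_of M h) ! (14 + c) = stretch (points (part_of M g) ! c)"
      using False low_ring_stretch [of c] by (auto simp: nth_append)
    then show ?thesis using h Suc by (simp add: pos_def emb_stretch)
  qed
qed

lemma pos_link:
  assumes "g \<le> M" "1 \<le> M" "(a, b) \<in> set (links (part_of M g))"
  shows "pos M (14 * g + a) = turn ^ g * emb (points (part_of M g) ! a)"
    "pos M (14 * g + b) = turn ^ g * emb (points (part_of M g) ! b)"
proof -
  note l = links_bounds [OF assms(3)]
  have i: "g = 0 \<Longrightarrow> 13 \<le> a" using l(6) by (simp add: part_of_def)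
  have o: "g = M" if "b = 28"
  proof (rule ccontr)
    assume "g \<noteq> M"
    then have "part_of M g \<noteq> Outer" using assms(1) by (simp add: part_of_def)
    then show False using l(5) that by simp
  qed
  show "pos M (14 * g + a) = turn ^ g * emb (points (part_of M g) ! a)"
    using l i assms by (intro pos_code) auto
  show "pos M (14 * g + b) = turn ^ g * emb (points (part_of M g) ! b)"
    using l(2,3) o assms by (intro pos_code) (auto simp: le_less)
qed

lemma turn_nonzero: "turn \<noteq> 0" by (simp add: turn_def)

lemma scaled_segment:
  fixes m :: complex
  shows "closed_segment (m * x) (m * y) = (*) m ` closed_segment x y"
  by (rule closed_segment_linear_image) (simp add: linear_times)

text \<open>All positions are values of one function \<open>f\<close> of the codes, so a shared code
  forces the listed points to agree.\<close>

lemma compatible_meet: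
  fixes f :: "int \<Rightarrow> complex"
  assumes com: "compatible ((a, p), (b, q)) ((c, r), (d, s))"
    and f: "f a = emb p" "f b = emb q" "f c = emb r" "f d = emb s"
    and ne: "\<not> (a = c \<and> b = d)" "\<not> (a = d \<and> b = c)"
  shows "closed_segment (f a) (f b) \<inter> closed_segment (f c) (f d) \<subseteq> f ` ({a, b} \<inter> {c, d})"
proof -
  consider "a = c" "diverging p q s" | "a \<noteq> c" "a = d" "diverging p q r"
    | "b = c" "diverging q p s" | "b = d" "diverging q p r" | "separated p q r s"
    using com ne by (auto split: if_splits)
  then show ?thesis
  proof cases
    case 1
    then have "p = r" using f emb_inject by metis
    then show ?thesis using diverging_segments [OF 1(2)] 1(1) by (auto simp: f)
  next
    case 2
    then have "p = s" using f emb_inject by metis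
    then have "closed_segment (f a) (f b) \<inter> closed_segment (f c) (f d) \<subseteq> {f a}"
      using diverging_segments [OF 2(3)] \<open>p = s\<close>
      unfolding closed_segment_commute [of "f c" "f d"] by (simp add: f)
    then show ?thesis using 2 by auto
  next
    case 3
    then have "q = r" using f emb_inject by metis
    then have "closed_segment (f a) (f b) \<inter> closed_segment (f c) (f d) \<subseteq> {f b}"
      using diverging_segments [OF 3(2)] \<open>q = r\<close>
      unfolding closed_segment_commute [of "f a" "f b"] by (simp add: f)
    then show ?thesis using 3 by auto
  next
    case 4
    then have "q = s" using f emb_inject by metis
    then have "closed_segment (f a) (f b) \<inter> closed_segment (f c) (f d) \<subseteq> {f b}"
      using diverging_segments [OF 4(2)] \<open>q = s\<close>
      unfolding closed_segment_commute [of "f a" "f b"] closed_segment_commute [of "f c" "f d"]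
      by (simp add: f)
    then show ?thesis using 4 by auto
  next
    case 5
    then show ?thesis using separated_segments [OF 5] by (simp add: f)
  qed
qed

lemma all_compatibleD: "all_compatible es fs \<Longrightarrow> e \<in> set es \<Longrightarrow> f \<in> set fs \<Longrightarrow> compatible e f"
  by (simp add: all_compatible_def list_all_iff)

lemma segment_of_link:
  "(a, b) \<in> set (links k) \<Longrightarrow> ((int a, points k ! a), (int b, points k ! b)) \<in> set (segments k)"
  by (force simp: segments_def)

lemma near_edges:
  assumes M: "2 \<le> M" and g: "g \<le> h" "h \<le> g + 1" "h \<le> M"
    and ab: "(a, b) \<in> set (links (part_of M g))" and cd: "(c, d) \<in> set (links (part_of M h))"
    and xy: "x = 14 * g + a" "y = 14 * g + b" and uv: "u = 14 * h + c" "v = 14 * h + d"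
    and ne: "{x, y} \<noteq> {u, v}"
  shows "closed_segment (pos M x) (pos M y) \<inter> closed_segment (pos M u) (pos M v) \<subseteq> pos M ` ({x, y} \<inter> {u, v})"
proof -
  \<comment> \<open>Dividing by \<open>turn ^ g\<close> and numbering from 14 g turns part
    \<open>g\<close> and the next one into the tabulated segments. Integer codes avoid truncated
    subtraction.\<close>
  define f where "f i = pos M (nat (i + 14 * int g)) / turn ^ g" for i
  have f: "pos M n = turn ^ g * f (int n - 14 * int g)" for n
    by (simp add: f_def turn_nonzero)
  have fab: "f (int a) = emb (points (part_of M g) ! a)" "f (int b) = emb (points (part_of M g) ! b)"
    using pos_link [OF _ _ ab] g M f [of x] f [of y] turn_nonzero by (simp_all add: xy)
  define i j where "i = int u - 14 * int g" and "j = int v - 14 * int g"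
  have meet: "closed_segment (f (int a)) (f (int b)) \<inter> closed_segment (f i) (f j) \<subseteq> f ` ({int a, int b} \<inter> {i, j})"
  proof (cases "g = h")
    case True
    have ij: "i = int c" "j = int d" using True by (simp_all add: i_def j_def uv)
    have fcd: "f i = emb (points (part_of M h) ! c)" "f j = emb (points (part_of M h) ! d)"
      using pos_link [OF _ _ cd] g M f [of u] f [of v] turn_nonzero True by (simp_all add: uv ij)
    have "all_compatible (segments (part_of M g)) (segments (part_of M h))"
      using compatible_parts True by (cases "part_of M g") auto
    from all_compatibleD [OF this segment_of_link [OF ab] segment_of_link [OF cd]]
    show ?thesis
      unfolding ij
    proof (rule compatible_meet [OF _ fab fcd [unfolded ij]])
      show "\<not> (int a = int c \<and> int b = int d)" "\<not> (int a = int d \<and> int b = int c)"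
        using ne True by (auto simp: xy uv)
    qed
  next
    case False
    then have h: "h = Suc g" using g by simp
    have ij: "i = int c + 14" "j = int d + 14" using h by (simp_all add: i_def j_def uv)
    have fcd: "f i = emb (stretch (points (part_of M h) ! c))" "f j = emb (stretch (points (part_of M h) ! d))"
      using pos_link [OF _ _ cd] g M f [of u] f [of v] turn_nonzero h
      by (simp_all add: uv i_def j_def emb_stretch)
    have "all_compatible (segments (part_of M g)) (map shift_segment (segments (part_of M h)))"
      using compatible_neighbours h g(3) M by (auto simp: part_of_def)
    moreover have "((int c + 14, stretch (points (part_of M h) ! c)), (int d + 14, stretch (points (part_of M h) ! d)))
        \<in> set (map shift_segment (segments (part_of M h)))"
      using imageI [OF segment_of_link [OF cd], of shift_segment] by simp
    ultimately have "compatible ((int a, points (part_of M g) ! a), (int b, points (part_of M g) ! b))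
       ((int c + 14, stretch (points (part_of M h) ! c)), (int d + 14, stretch (points (part_of M h) ! d)))"
      using all_compatibleD segment_of_link [OF ab] by blast
    then show ?thesis
      unfolding ij
    proof (rule compatible_meet [OF _ fab fcd [unfolded ij]])
      show "\<not> (int a = int c + 14 \<and> int b = int d + 14)" "\<not> (int a = int d + 14 \<and> int b = int c + 14)"
        using ne h by (auto simp: xy uv doubleton_eq_iff)
    qed
  qed
  have ends: "pos M x = turn ^ g * f (int a)" "pos M y = turn ^ g * f (int b)"
    "pos M u = turn ^ g * f i" "pos M v = turn ^ g * f j"
    using f by (simp_all add: xy i_def j_def)
  show ?thesis
  proof
    fix z assume "z \<in> closed_segment (pos M x) (pos M y) \<inter> closed_segment (pos M u) (pos M v)"
    then obtain w where w: "z = turn ^ g * w"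
      "w \<in> closed_segment (f (int a)) (f (int b)) \<inter> closed_segment (f i) (f j)"
      unfolding ends scaled_segment using turn_nonzero by auto
    then obtain k where k: "k \<in> {int a, int b}" "k \<in> {i, j}" "w = f k" using meet by blast
    define n where "n = nat (k + 14 * int g)"
    have kn: "k = int n - 14 * int g" using k(1) by (auto simp: n_def)
    then have "n \<in> {x, y}" "n \<in> {u, v}" using k(1,2) by (auto simp: xy i_def j_def)
    moreover have "z = pos M n" using f [of n] w(1) k(3) kn by simp
    ultimately show "z \<in> pos M ` ({x, y} \<inter> {u, v})" by blast
  qed
qed

section \<open>Edges at least two parts apart\<close>

definition box_norm :: "complex \<Rightarrow> real" where
  "box_norm z = max \<bar>Re z\<bar> \<bar>Im z\<bar>"

text \<open>Quarter turns preserve the maximum norm, so \<open>turn\<close> merely doubles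
  it.\<close>

lemma box_norm_turn: "box_norm (turn ^ g * z) = 2 ^ g * box_norm z"
proof (induction g arbitrary: z)
  case (Suc g)
  have "box_norm (turn * z) = 2 * box_norm z"
    by (simp add: box_norm_def turn_def abs_mult max_def)
  then show ?case using Suc [of "turn * z"] by (simp add: power_commutes mult.assoc mult.left_commute)
qed simp

lemma box_norm_segment:
  assumes "z \<in> closed_segment x y" "box_norm x \<le> r" "box_norm y \<le> r"
  shows "box_norm z \<le> r"
proof -
  obtain t where t: "0 \<le> t" "t \<le> 1" "z = (1 - t) *\<^sub>R x + t *\<^sub>R y"
    using assms(1) by (auto simp: closed_segment_def)
  have *: "\<bar>(1 - t) * p + t * q\<bar> \<le> r" if "\<bar>p\<bar> \<le> r" "\<bar>q\<bar> \<le> r" for p q :: real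
  proof -
    have "(1 - t) * p + t * q \<le> r" "(1 - t) * (- p) + t * (- q) \<le> r"
      using that t by (intro convex_bound_le; auto)+
    then show ?thesis by simp
  qed
  show ?thesis using assms(2,3) * by (simp add: box_norm_def t(3))
qed

text \<open>Along the segment the linear form \<open>L\<close> exceeds 3/2 times its dual norm, the
  sum of the absolute values of \<open>R\<close> and \<open>S\<close>; on the other hand it is at
  most the dual norm times \<open>box_norm\<close>.\<close>

lemma clear_segment:
  assumes clear: "clear_of_box ((a, p), (b, q))" and z: "z \<in> closed_segment (emb p) (emb q)"
  shows "box_norm z > 3 / 2"
proof -
  obtain x y u v where pq: "p = (x, y)" "q = (u, v)" by (cases p; cases q)
  obtain r s where rs: "(r, s) \<noteq> (0, 0)" "2 * (r * x + s * y) > 3 * (\<bar>r\<bar> + \<bar>s\<bar>)"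
    "2 * (r * u + s * v) > 3 * (\<bar>r\<bar> + \<bar>s\<bar>)"
  proof -
    obtain w where w: "w \<in> set [(1, 0), (-1, 0), (0, 1), (0, -1), (1, 1), (1, -1), (-1, 1), (-1, -1 :: int)]"
      "case w of (r, s) \<Rightarrow> 2 * (r * x + s * y) > 3 * (\<bar>r\<bar> + \<bar>s\<bar>) \<and> 2 * (r * u + s * v) > 3 * (\<bar>r\<bar> + \<bar>s\<bar>)"
      using clear unfolding pq clear_of_box.simps list_ex_iff by (rule bexE)
    moreover obtain r s where "w = (r, s)" by (cases w)
    ultimately show ?thesis using that [of r s] by auto
  qed
  define R S where "R = real_of_int r" and "S = real_of_int s"
  define L where "L w = R * Re w + S * Im w" for w
  obtain t where t: "0 \<le> t" "t \<le> 1" "z = (1 - t) *\<^sub>R emb p + t *\<^sub>R emb q"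
    using z by (auto simp: closed_segment_def)
  have "real_of_int (2 * (r * x + s * y)) > real_of_int (3 * (\<bar>r\<bar> + \<bar>s\<bar>))"
    using rs(2) by (simp only: of_int_less_iff)
  then have "3 * (\<bar>R\<bar> + \<bar>S\<bar>) < 2 * L (emb p)" by (simp add: L_def R_def S_def pq)
  then have 1: "- L (emb p) < - (3 / 2 * (\<bar>R\<bar> + \<bar>S\<bar>))" by (simp add: field_simps)
  have "real_of_int (2 * (r * u + s * v)) > real_of_int (3 * (\<bar>r\<bar> + \<bar>s\<bar>))"
    using rs(3) by (simp only: of_int_less_iff)
  then have "3 * (\<bar>R\<bar> + \<bar>S\<bar>) < 2 * L (emb q)" by (simp add: L_def R_def S_def pq)
  then have 2: "- L (emb q) < - (3 / 2 * (\<bar>R\<bar> + \<bar>S\<bar>))" by (simp add: field_simps)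
  have "(1 - t) * (- L (emb p)) + t * (- L (emb q)) < - (3 / 2 * (\<bar>R\<bar> + \<bar>S\<bar>))"
    by (rule convex_bound_lt [OF 1 2]) (use t in auto)
  moreover have "L z = (1 - t) * L (emb p) + t * L (emb q)"
    by (simp add: L_def t(3) algebra_simps)
  ultimately have "L z > 3 / 2 * (\<bar>R\<bar> + \<bar>S\<bar>)" by (simp add: field_simps)
  moreover have "L z \<le> (\<bar>R\<bar> + \<bar>S\<bar>) * box_norm z"
  proof -
    have "R * Re z \<le> \<bar>R\<bar> * box_norm z" "S * Im z \<le> \<bar>S\<bar> * box_norm z"
      unfolding box_norm_def
      by (metis abs_ge_self abs_ge_zero abs_mult max.cobounded1 max.cobounded2 mult_left_mono order_trans)+
    then show ?thesis by (simp add: L_def algebra_simps)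
  qed
  ultimately have "3 / 2 * (\<bar>R\<bar> + \<bar>S\<bar>) < (\<bar>R\<bar> + \<bar>S\<bar>) * box_norm z" by linarith
  moreover have "\<bar>R\<bar> + \<bar>S\<bar> > 0" using rs(1) by (auto simp: R_def S_def)
  ultimately show ?thesis by (metis mult.commute mult_less_cancel_left_pos)
qed

lemma points_small:
  "list_all (\<lambda>z. \<bar>fst z\<bar> \<le> 6 \<and> \<bar>snd z\<bar> \<le> 6) (points Inner)"
  "list_all (\<lambda>z. \<bar>fst z\<bar> \<le> 6 \<and> \<bar>snd z\<bar> \<le> 6) (points Middle)"
  by code_simp+

lemma length_points: "length (points k) = (if k = Outer then 29 else 28)"
  by (induct k; code_simp)

lemma points_bound:
  assumes "k \<noteq> Outer" "c < 28"
  shows "box_norm (emb (points k ! c)) \<le> 6"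
proof -
  have all: "list_all (\<lambda>z. \<bar>fst z\<bar> \<le> 6 \<and> \<bar>snd z\<bar> \<le> 6) (points k)" and len: "length (points k) = 28"
    using assms(1) points_small length_points [of k] by (cases k; simp)+
  have "points k ! c \<in> set (points k)" using assms(2) len by simp
  from all [unfolded list_all_iff, rule_format, OF this]
  have "\<bar>fst (points k ! c)\<bar> \<le> 6 \<and> \<bar>snd (points k ! c)\<bar> \<le> 6" .
  then have "real_of_int \<bar>fst (points k ! c)\<bar> \<le> real_of_int 6" "real_of_int \<bar>snd (points k ! c)\<bar> \<le> real_of_int 6"
    by (simp_all only: of_int_le_iff)
  then show ?thesis by (simp add: box_norm_def)
qed

text \<open>Part \<open>g\<close> fits into the box of radius 6 times \<open>2 ^ g\<close>. The
  radius 3/2 of the clear box is a quarter of 6, and two steps outwards multiply it by 4.\<close>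

lemma far_edges:
  assumes M: "2 \<le> M" and g: "g + 2 \<le> h" "h \<le> M"
    and ab: "(a, b) \<in> set (links (part_of M g))" and cd: "(c, d) \<in> set (links (part_of M h))"
  shows "closed_segment (pos M (14 * g + a)) (pos M (14 * g + b)) \<inter>
    closed_segment (pos M (14 * h + c)) (pos M (14 * h + d)) = {}"
proof -
  have kg: "part_of M g \<noteq> Outer" using g by (auto simp: part_of_def)
  have ge: "g \<le> M" "1 \<le> M" using g M by auto
  have "box_norm z \<le> 2 ^ g * 6"
    if "z \<in> closed_segment (pos M (14 * g + a)) (pos M (14 * g + b))" for z
    using links_bounds(4,5) [OF ab] kg points_bound [OF kg]
    by (intro box_norm_segment [OF that]) (simp_all add: pos_link [OF ge ab] box_norm_turn)
  moreover have "box_norm z > 2 ^ g * 6"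
    if z: "z \<in> closed_segment (pos M (14 * h + c)) (pos M (14 * h + d))" for z
  proof -
    obtain w where w: "z = turn ^ h * w"
      "w \<in> closed_segment (emb (points (part_of M h) ! c)) (emb (points (part_of M h) ! d))"
      using z unfolding pos_link [OF g(2) ge(2) cd] scaled_segment by (elim imageE) (rule that)
    have "part_of M h \<in> {Middle, Outer}" using g by (auto simp: part_of_def)
    then have "list_all clear_of_box (segments (part_of M h))" using clear_parts by auto
    then have "box_norm w > 3 / 2"
      using segment_of_link [OF cd] clear_segment [OF _ w(2)] by (auto simp: list_all_iff)
    then have "2 ^ h * box_norm w > 2 ^ h * (3 / 2)" by simp
    moreover have "2 ^ h * (3 / 2) \<ge> (2::real) ^ (g + 2) * (3 / 2)"
      using g(1) by (intro mult_right_mono power_increasing) auto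
    moreover have "(2::real) ^ (g + 2) * (3 / 2) = 2 ^ g * 6" by simp
    ultimately show ?thesis unfolding w(1) box_norm_turn by linarith
  qed
  ultimately show ?thesis by (metis disjoint_iff not_le)
qed

lemma edges_meet:
  assumes M: "2 \<le> M" and g: "g \<le> M" "h \<le> M"
    and ab: "(a, b) \<in> set (links (part_of M g))" and cd: "(c, d) \<in> set (links (part_of M h))"
    and xy: "x = 14 * g + a" "y = 14 * g + b" and uv: "u = 14 * h + c" "v = 14 * h + d"
    and ne: "{x, y} \<noteq> {u, v}"
  shows "closed_segment (pos M x) (pos M y) \<inter> closed_segment (pos M u) (pos M v) \<subseteq> pos M ` ({x, y} \<inter> {u, v})"
proof -
  consider "g \<le> h" "h \<le> g + 1" | "h \<le> g" "g \<le> h + 1" | "g + 2 \<le> h" | "h + 2 \<le> g" by linarith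
  then show ?thesis
  proof cases
    case 1
    then show ?thesis using near_edges [OF M _ _ g(2) ab cd xy uv ne] by blast
  next
    case 2
    then show ?thesis using near_edges [OF M _ _ g(1) cd ab uv xy ne [symmetric]] by (simp add: Int_commute)
  next
    case 3
    then show ?thesis using far_edges [OF M _ g(2) ab cd] by (simp add: xy uv)
  next
    case 4
    then show ?thesis using far_edges [OF M _ g(1) cd ab] by (simp add: xy uv Int_commute)
  qed
qed

section \<open>Distinct vertices and planarity of the spiral graphs\<close>

lemma ring_points:
  assumes "14 \<le> c" "c < length (points k)"
  shows "4 \<le> box_norm (emb (points k ! c))"
    "14 \<le> d \<Longrightarrow> d < length (points k) \<Longrightarrow> points k ! c = points k ! d \<Longrightarrow> c = d"
proof -
  have 1: "list_all (\<lambda>z. 4 \<le> \<bar>fst z\<bar> \<or> 4 \<le> \<bar>snd z\<bar>) (drop 14 (points k))" and 2: "distinct (drop 14 (points k))"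
    by (induct k; code_simp)+
  have nth: "points k ! i = drop 14 (points k) ! (i - 14)" "i - 14 < length (drop 14 (points k))"
    if "14 \<le> i" "i < length (points k)" for i using that by auto
  have "drop 14 (points k) ! (c - 14) \<in> set (drop 14 (points k))"
    by (rule nth_mem [OF nth(2) [OF assms]])
  from 1 [unfolded list_all_iff, rule_format, OF this]
  have "4 \<le> \<bar>fst (points k ! c)\<bar> \<or> 4 \<le> \<bar>snd (points k ! c)\<bar>" using nth(1) [OF assms] by simp
  then have "real_of_int 4 \<le> real_of_int \<bar>fst (points k ! c)\<bar> \<or> real_of_int 4 \<le> real_of_int \<bar>snd (points k ! c)\<bar>"
    by (simp only: of_int_le_iff)
  then show "4 \<le> box_norm (emb (points k ! c))" by (auto simp: box_norm_def le_max_iff_disj)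
  assume d: "14 \<le> d" "d < length (points k)" "points k ! c = points k ! d"
  have "drop 14 (points k) ! (c - 14) = drop 14 (points k) ! (d - 14)"
    by (simp only: nth(1) [OF assms, symmetric] nth(1) [OF d(1,2), symmetric] d(3))
  then have "c - 14 = d - 14"
    using nth_eq_iff_index_eq [OF 2] nth(2) [OF assms] nth(2) [OF d(1,2)] by blast
  then show "c = d" using assms d by simp
qed

lemma vertex_cases:
  assumes "v \<in> spiral_verts M" "1 \<le> M"
  obtains "v = 13" | g c where "v = 14 * g + c" "g \<le> M" "14 \<le> c" "c < length (points (part_of M g))"
    "c < 28 \<or> c = 28 \<and> g = M"
proof (cases "v = 13")
  case False
  then have v: "14 \<le> v" "v \<le> 14 * (M + 2)" using assms by (auto simp: spiral_verts_def)
  show ?thesis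
  proof (cases "v = 14 * (M + 2)")
    case True
    then show ?thesis using assms(2) by (intro that(2) [of M 28]) (simp_all add: length_points part_of_def del: points.simps)
  next
    case False
    have lt: "v div 14 < M + 2" using v(2) False by (intro less_mult_imp_div_less) simp
    obtain h where h: "v div 14 = Suc h" using v(1) by (cases "v div 14") auto
    have "v = 14 * h + (14 + v mod 14)" using mult_div_mod_eq [of 14 v] h by simp
    moreover have "h \<le> M" "14 + v mod 14 < 28" using lt h by simp_all
    ultimately show ?thesis
      by (intro that(2) [of h "14 + v mod 14"]) (auto simp: length_points simp del: points.simps)
  qed
qed (use that in blast)

lemma pos_center: "1 \<le> M \<Longrightarrow> pos M 13 = 0"
  using pos_code [of 0 M 13] by (simp add: part_of_def emb_def Complex_eq_0 nth_append)

lemma inj_on_pos: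
  assumes M: "1 \<le> M"
  shows "inj_on (pos M) (spiral_verts M)"
proof (rule inj_onI)
  have ring_norm: "2 ^ g * 4 \<le> box_norm (pos M (14 * g + c))" "g < M \<Longrightarrow> box_norm (pos M (14 * g + c)) \<le> 2 ^ g * 6"
    if c: "g \<le> M" "14 \<le> c" "c < length (points (part_of M g))" "c < 28 \<or> c = 28 \<and> g = M" for g c
  proof -
    have p: "pos M (14 * g + c) = turn ^ g * emb (points (part_of M g) ! c)"
      using c M by (intro pos_code) auto
    show "2 ^ g * 4 \<le> box_norm (pos M (14 * g + c))"
      unfolding p box_norm_turn using ring_points(1) [OF c(2,3)] by simp
    show "box_norm (pos M (14 * g + c)) \<le> 2 ^ g * 6" if "g < M"
      unfolding p box_norm_turn using points_bound [of "part_of M g" c] that c(4) by (simp add: part_of_def)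
  qed
  have pos_ring: "0 < box_norm (pos M (14 * g + c))"
    if "g \<le> M" "14 \<le> c" "c < length (points (part_of M g))" "c < 28 \<or> c = 28 \<and> g = M" for g c
    using ring_norm(1) [OF that] by (rule less_le_trans [rotated]) simp
  \<comment> \<open>In units of \<open>2 ^ g\<close>, ring \<open>g\<close> with g < M stays within
    norm 6, while all later rings have norm at least 8.\<close>
  have level: "g \<ge> h" if eq: "pos M (14 * g + c) = pos M (14 * h + d)"
    and c: "g \<le> M" "14 \<le> c" "c < length (points (part_of M g))" "c < 28 \<or> c = 28 \<and> g = M"
    and d: "h \<le> M" "14 \<le> d" "d < length (points (part_of M h))" "d < 28 \<or> d = 28 \<and> h = M" for g h c d
  proof (rule ccontr)
    assume "\<not> g \<ge> h"
    then have gh: "g + 1 \<le> h" "g < M" using d(1) by auto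
    then have "(2::real) ^ (g + 1) * 4 \<le> 2 ^ h * 4" by (intro mult_right_mono power_increasing) auto
    also have "\<dots> \<le> 2 ^ g * 6" using ring_norm(1) [OF d] ring_norm(2) [OF c gh(2)] eq by simp
    finally show False by simp
  qed
  fix v w assume v: "v \<in> spiral_verts M" and w: "w \<in> spiral_verts M" and eq: "pos M v = pos M w"
  have zero: "box_norm (pos M 13) = 0" by (simp add: pos_center [OF M] box_norm_def)
  show "v = w"
  proof (cases rule: vertex_cases [OF v M])
    case 1
    show ?thesis
    proof (cases rule: vertex_cases [OF w M])
      case 1
      then show ?thesis using \<open>v = 13\<close> by simp
    next
      case (2 h d)
      then show ?thesis using pos_ring [OF 2(2-5)] zero eq 1 by simp
    qed
  next
    case (2 g c)
    note c = this
    show ?thesis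
    proof (cases rule: vertex_cases [OF w M])
      case 1
      then show ?thesis using pos_ring [OF c(2-5)] zero eq c(1) by simp
    next
      case (2 h d)
      note d = this
      have "g = h"
        using level [OF eq [unfolded c(1) d(1)] c(2-5) d(2-5)]
          level [OF eq [symmetric, unfolded c(1) d(1)] d(2-5) c(2-5)] by simp
      moreover have "pos M v = turn ^ g * emb (points (part_of M g) ! c)"
        unfolding c(1) using c M by (intro pos_code) auto
      moreover have "pos M w = turn ^ h * emb (points (part_of M h) ! d)"
        unfolding d(1) using d M by (intro pos_code) auto
      ultimately have "points (part_of M g) ! c = points (part_of M g) ! d"
        using eq turn_nonzero by (simp add: emb_inject)
      then have "c = d" using ring_points(2) [OF c(3,4)] d \<open>g = h\<close> by blast
      then show ?thesis using c d \<open>g = h\<close> by simp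
    qed
  qed
qed

lemma spiral_edge_in:
  assumes "g \<le> M" "(a, b) \<in> set (links (part_of M g))"
  shows "14 * g + a \<in> spiral_verts M" "14 * g + b \<in> spiral_verts M" "14 * g + a < 14 * g + b"
proof -
  note l = links_bounds [OF assms(2)]
  have "13 \<le> 14 * g + a" using l(6) by (cases "g = 0") (auto simp: part_of_def)
  then show "14 * g + a \<in> spiral_verts M" "14 * g + b \<in> spiral_verts M" "14 * g + a < 14 * g + b"
    using l(1-4) assms(1) by (auto simp: spiral_verts_def)
qed

lemma simple_spiral: "simple_graph (spiral M)"
  unfolding simple_graph_def
proof (intro conjI ballI)
  show "finite (verts (spiral M))" by (simp add: spiral_verts_def)
  fix e assume "e \<in> edges (spiral M)"
  then obtain g a b where e: "e = {14 * g + a, 14 * g + b}" "g \<le> M" "(a, b) \<in> set (links (part_of M g))"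
    by (auto simp: spiral_edges_def)
  show "e \<subseteq> verts (spiral M)" "card e = 2"
    using spiral_edge_in [OF e(2,3)] by (simp_all add: e(1))
qed

text \<open>Since every vertex is an end of some edge, a vertex on a foreign edge would be a point
  where two edges meet. The condition on vertices in a drawing thus follows from the one on pairs of
  edges.\<close>

lemma spiral_incident:
  assumes "v \<in> spiral_verts M" "1 \<le> M"
  shows "\<exists>e\<in>spiral_edges M. v \<in> e"
  using assms
proof (cases rule: vertex_cases)
  case 1
  have "(13, 14) \<in> set (links (part_of M 0))" by (simp add: part_of_def links_def)
  then have "{14 * 0 + 13, 14 * 0 + 14} \<in> spiral_edges M" unfolding spiral_edges_def by blast
  then show ?thesis using 1 by (intro bexI) auto
next
  case (2 g c)
  have "\<exists>d. (c, d) \<in> set (links (part_of M g)) \<or> (d, c) \<in> set (links (part_of M g))"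
  proof (cases "c < 28")
    case True
    then show ?thesis using links_cover 2(3) by blast
  next
    case False
    then have "part_of M g = Outer" "c = 28" using 2 assms(2) by (auto simp: part_of_def)
    then show ?thesis by (intro exI [of _ 16]) (simp add: links_def)
  qed
  then obtain d where "{14 * g + c, 14 * g + d} \<in> spiral_edges M"
    using 2(2) unfolding spiral_edges_def by (auto simp: insert_commute)
  then show ?thesis using 2(1) by (intro bexI) auto
qed

lemma planar_spiral:
  assumes M: "2 \<le> M"
  shows "planar (spiral M)"
proof -
  \<comment> \<open>\<open>Min\<close> and \<open>Max\<close> choose a direction, as the path may
    depend only on the edge as a set.\<close>
  define \<gamma> where "\<gamma> e = linepath (pos M (Min e)) (pos M (Max e))" for e
  have edge: "\<exists>x y. e = {x, y} \<and> pos M x \<noteq> pos M y \<and> \<gamma> e = linepath (pos M x) (pos M y) \<and>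
      path_image (\<gamma> e) = closed_segment (pos M x) (pos M y)" if e: "e \<in> spiral_edges M" for e
  proof -
    obtain g a b where gab: "e = {14 * g + a, 14 * g + b}" "g \<le> M" "(a, b) \<in> set (links (part_of M g))"
      using e by (auto simp: spiral_edges_def)
    note in_verts = spiral_edge_in [OF gab(2,3)]
    have "\<gamma> e = linepath (pos M (14 * g + a)) (pos M (14 * g + b))"
      using in_verts(3) by (simp add: \<gamma>_def gab(1))
    moreover have "pos M (14 * g + a) \<noteq> pos M (14 * g + b)"
      using inj_onD [OF inj_on_pos _ in_verts(1,2)] in_verts(3) M by fastforce
    ultimately show ?thesis using gab(1) by (intro exI [of _ "14 * g + a"] exI [of _ "14 * g + b"]) simp
  qed
  have meet: "path_image (\<gamma> e) \<inter> path_image (\<gamma> e') \<subseteq> pos M ` (e \<inter> e')"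
    if e: "e \<in> spiral_edges M" "e' \<in> spiral_edges M" "e \<noteq> e'" for e e'
  proof -
    obtain g a b where gab: "e = {14 * g + a, 14 * g + b}" "g \<le> M" "(a, b) \<in> set (links (part_of M g))"
      using e(1) by (auto simp: spiral_edges_def)
    obtain h c d where hcd: "e' = {14 * h + c, 14 * h + d}" "h \<le> M" "(c, d) \<in> set (links (part_of M h))"
      using e(2) by (auto simp: spiral_edges_def)
    have "path_image (\<gamma> e) = closed_segment (pos M (14 * g + a)) (pos M (14 * g + b))"
      "path_image (\<gamma> e') = closed_segment (pos M (14 * h + c)) (pos M (14 * h + d))"
      using spiral_edge_in(3) [OF gab(2,3)] spiral_edge_in(3) [OF hcd(2,3)]
      by (simp_all add: \<gamma>_def gab(1) hcd(1))
    moreover have "{14 * g + a, 14 * g + b} \<noteq> {14 * h + c, 14 * h + d}"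
      using e(3) unfolding gab(1) hcd(1) .
    ultimately show ?thesis
      using edges_meet [OF M gab(2) hcd(2) gab(3) hcd(3) refl refl refl refl]
      unfolding gab(1) hcd(1) by simp
  qed
  have "path_image (\<gamma> e) \<inter> pos M ` spiral_verts M = pos M ` e" if e: "e \<in> spiral_edges M" for e
  proof
    obtain x y where xy: "e = {x, y}" "path_image (\<gamma> e) = closed_segment (pos M x) (pos M y)"
      using edge [OF e] by blast
    have sub: "e \<subseteq> spiral_verts M" using simple_spiral [of M] e by (simp add: simple_graph_def)
    show "pos M ` e \<subseteq> path_image (\<gamma> e) \<inter> pos M ` spiral_verts M"
      using sub unfolding xy(2) unfolding xy(1) by auto
    show "path_image (\<gamma> e) \<inter> pos M ` spiral_verts M \<subseteq> pos M ` e"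
    proof clarify
      fix v assume v: "v \<in> spiral_verts M" "pos M v \<in> path_image (\<gamma> e)"
      obtain e' where e': "e' \<in> spiral_edges M" "v \<in> e'" using spiral_incident [OF v(1)] M by auto
      show "pos M v \<in> pos M ` e"
      proof (cases "e' = e")
        case False
        obtain x' y' where "e' = {x', y'}" "path_image (\<gamma> e') = closed_segment (pos M x') (pos M y')"
          using edge [OF e'(1)] by blast
        then have "pos M v \<in> path_image (\<gamma> e')" using e'(2) by auto
        then show ?thesis using meet [OF e e'(1)] v(2) False by blast
      qed (use e' in blast)
    qed
  qed
  moreover have "arc (\<gamma> e)" "{pathstart (\<gamma> e), pathfinish (\<gamma> e)} = pos M ` e" if "e \<in> spiral_edges M" for e
    using edge [OF that] by (auto simp: arc_linepath)
  ultimately have "plane_drawing (spiral M) (pos M) \<gamma>"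
    unfolding plane_drawing_def using inj_on_pos [of M] M meet by auto
  then show ?thesis unfolding planar_def by blast
qed

section \<open>Four-cycles in the spiral graphs\<close>

definition linked :: "nat \<Rightarrow> nat \<Rightarrow> nat \<Rightarrow> nat \<Rightarrow> bool" where
  "linked M g x y \<longleftrightarrow> g \<le> M \<and> (\<exists>(a, b)\<in>set (links (part_of M g)).
     x = 14 * g + a \<and> y = 14 * g + b \<or> x = 14 * g + b \<and> y = 14 * g + a)"

lemma linked_commute: "linked M g x y \<longleftrightarrow> linked M g y x"
  unfolding linked_def by auto

lemma spiral_edge_linked: "{x, y} \<in> spiral_edges M \<Longrightarrow> \<exists>g. linked M g x y"
  unfolding spiral_edges_def linked_def by (fastforce simp: doubleton_eq_iff)

lemma linked_bounds:
  assumes "linked M g x y"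
  shows "14 * g \<le> x" "g < M \<Longrightarrow> x < 14 * (g + 2)" "x \<le> 14 * g + 28" "14 * (g + 1) \<le> max x y" "max x y \<le> 14 * g + 28" "g \<le> M"
proof -
  obtain a b where ab: "(a, b) \<in> set (links (part_of M g))" "g \<le> M"
    "x = 14 * g + a \<and> y = 14 * g + b \<or> x = 14 * g + b \<and> y = 14 * g + a"
    using assms unfolding linked_def by blast
  have "part_of M g \<noteq> Outer" if "g < M" using that by (simp add: part_of_def)
  then show "14 * g \<le> x" "g < M \<Longrightarrow> x < 14 * (g + 2)" "x \<le> 14 * g + 28" "14 * (g + 1) \<le> max x y" "max x y \<le> 14 * g + 28" "g \<le> M"
    using ab links_bounds [OF ab(1)] by auto
qed

lemma linked_levels:
  assumes "linked M g x y" "linked M h y z"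
  shows "h \<le> g + 1" "g \<le> h + 1"
proof -
  have g: "linked M g y x" using assms(1) linked_commute by blast
  show "h \<le> g + 1"
    using linked_bounds(1,6) [OF assms(2)] linked_bounds(2,6) [OF g] by (cases "g < M") auto
  show "g \<le> h + 1"
    using linked_bounds(1,6) [OF g] linked_bounds(2,6) [OF assms(2)] by (cases "h < M") auto
qed

lemma window_neighbours:
  assumes xy: "linked M g x y" and g: "s \<le> g" "g \<le> s + 2"
  shows "int y - 14 * int s \<in> set (neighbours
    (window (part_of M s) (part_of M (s + 1)) (part_of M (s + 2))) (int x - 14 * int s))"
proof -
  obtain a b where ab: "(a, b) \<in> set (links (part_of M g))"
    "x = 14 * g + a \<and> y = 14 * g + b \<or> x = 14 * g + b \<and> y = 14 * g + a"
    using xy unfolding linked_def by blast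
  have "(int a + 14 * (int g - int s), int b + 14 * (int g - int s)) \<in> set (offset (14 * (int g - int s)) (part_of M g))"
    using ab(1) by (force simp: offset_def)
  moreover consider "g = s" | "g = s + 1" | "g = s + 2" using g by linarith
  then have "set (offset (14 * (int g - int s)) (part_of M g)) \<subseteq>
      set (window (part_of M s) (part_of M (s + 1)) (part_of M (s + 2)))"
    by cases (auto simp: window_def)
  ultimately have in_window: "(int a + 14 * (int g - int s), int b + 14 * (int g - int s)) \<in>
      set (window (part_of M s) (part_of M (s + 1)) (part_of M (s + 2)))" by blast
  show ?thesis using ab(2)
  proof
    assume "x = 14 * g + a \<and> y = 14 * g + b"
    then show ?thesis using in_window by (force simp: neighbours_def algebra_simps)
  next
    assume "x = 14 * g + b \<and> y = 14 * g + a"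
    then show ?thesis using in_window by (force simp: neighbours_def algebra_simps)
  qed
qed

text \<open>Unless \<open>d\<close> is filtered out, the blocks of \<open>a\<close> and of
  \<open>c\<close> both contribute it to the list.\<close>

lemma distinct_two_steps:
  assumes "distinct (filter (\<lambda>z. z \<noteq> v) (concat (map f xs)))"
    and "a \<in> set xs" "c \<in> set xs" "a \<noteq> c" "d \<in> set (f a)" "d \<in> set (f c)"
  shows "d = v"
  using assms by (induction xs) auto

text \<open>Consecutive edges of a four-cycle lie in the same part or in adjacent ones, so the whole cycle
  lies in three consecutive parts.\<close>

lemma no_four_cycle_window:
  assumes uniq: "uniquely_linked (window (part_of M s) (part_of M (s + 1)) (part_of M (s + 2))) vs"
    and v: "int b - 14 * int s \<in> set vs"
    and l: "linked M g1 b a" "linked M g2 b c" "linked M g3 a d" "linked M g4 c d"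
    and g: "s \<le> g1" "g1 \<le> s + 2" "s \<le> g2" "g2 \<le> s + 2" "s \<le> g3" "g3 \<le> s + 2" "s \<le> g4" "g4 \<le> s + 2"
    and ac: "a \<noteq> c"
  shows "d = b"
proof -
  let ?i = "\<lambda>x. int x - 14 * int s"
  let ?W = "window (part_of M s) (part_of M (s + 1)) (part_of M (s + 2))"
  have "distinct (two_steps ?W (?i b))"
    using uniq v by (simp add: uniquely_linked_def list_all_iff)
  then have "?i d = ?i b"
    unfolding two_steps_def
    using window_neighbours [OF l(1) g(1,2)] window_neighbours [OF l(2) g(3,4)]
      window_neighbours [OF l(3) g(5,6)] window_neighbours [OF l(4) g(7,8)] ac
    by (intro distinct_two_steps [of "?i b" "neighbours ?W" "neighbours ?W (?i b)" "?i a" "?i c"]) auto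
  then show ?thesis by simp
qed

text \<open>For \<open>M = 2\<close> the only window would run from \<open>Inner\<close> to
  \<open>Outer\<close>, which is not a tested combination.\<close>

lemma window_kinds:
  assumes "3 \<le> M" "s + 2 \<le> M"
  shows "uniquely_linked (window (part_of M s) (part_of M (s + 1)) (part_of M (s + 2))) [14..27]"
    "s + 2 = M \<Longrightarrow> uniquely_linked (window (part_of M s) (part_of M (s + 1)) (part_of M (s + 2))) [14..56]"
proof -
  show last: "uniquely_linked (window (part_of M s) (part_of M (s + 1)) (part_of M (s + 2))) [14..56]" if "s + 2 = M"
    using uniquely_linked_windows(3) that assms(1) by (auto simp: part_of_def)
  show "uniquely_linked (window (part_of M s) (part_of M (s + 1)) (part_of M (s + 2))) [14..27]"
  proof (cases "s + 2 = M")
    case True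
    have "set [14..27::int] \<subseteq> set [14..56]" by auto
    then show ?thesis using last [OF True] unfolding uniquely_linked_def list_all_iff by blast
  next
    case False
    then show ?thesis using uniquely_linked_windows(1,2) assms by (cases "s = 0") (simp_all add: part_of_def)
  qed
qed

text \<open>A window starting at the lowest part of the cycle contains all four edges. The edge in
  that part has an end on the ring of the part, with code 14 to 27, and the test is applied there.
  If fewer than three parts remain, the last window starts below the cycle, and every vertex of the
  cycle is among its tested codes.\<close>

lemma no_four_cycle_min:
  assumes M: "3 \<le> M" and dis: "a \<noteq> c" "b \<noteq> d"
    and l: "linked M g1 a b" "linked M g2 b c" "linked M g3 c d" "linked M g4 d a"
    and min: "g1 \<le> g2" "g1 \<le> g3" "g1 \<le> g4"
  shows False
proof -
  have near: "g2 \<le> g1 + 1" "g4 \<le> g1 + 1" "g3 \<le> g2 + 1"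
    using linked_levels [OF l(1,2)] linked_levels [OF l(4,1)] linked_levels [OF l(2,3)] by auto
  have le: "g1 \<le> M" "g2 \<le> M" "g3 \<le> M" "g4 \<le> M" using l linked_bounds(6) by blast+
  have l': "linked M g1 b a" "linked M g2 c b" "linked M g3 d c" "linked M g4 a d"
    using l linked_commute by blast+
  show False
  proof (cases "g1 + 2 \<le> M")
    case True
    note W = window_kinds(1) [OF M True]
    have "g1 < M" using True by simp
    have "14 * (g1 + 1) \<le> max a b" "max a b < 14 * (g1 + 2)"
      using linked_bounds(2,4) [OF l(1)] linked_bounds(2) [OF l'(1)] \<open>g1 < M\<close> by auto
    then have "14 \<le> int a - 14 * int g1 \<and> int a - 14 * int g1 \<le> 27 \<or>
        14 \<le> int b - 14 * int g1 \<and> int b - 14 * int g1 \<le> 27"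
      by (cases "a \<le> b"; simp add: max_def; linarith)
    then consider "int a - 14 * int g1 \<in> set [14..27]" | "int b - 14 * int g1 \<in> set [14..27]"
      unfolding set_upto atLeastAtMost_iff by blast
    then show False
    proof cases
      case 1
      have "c = a"
        by (rule no_four_cycle_window [OF W 1 l'(4) l(1) l'(3) l(2)]) (use near min dis in auto)
      then show False using dis by simp
    next
      case 2
      have "d = b"
        by (rule no_four_cycle_window [OF W 2 l'(1) l(2) l'(4) l(3)]) (use near min dis in auto)
      then show False using dis by simp
    qed
  next
    case False
    define s where "s = M - 2"
    have s: "s + 2 = M" "s + 2 \<le> M" using M by (auto simp: s_def)
    have g: "s + 1 \<le> g1" using False s by simp
    have "14 * s + 14 \<le> b" using linked_bounds(1) [OF l'(1)] g by simp
    then have "14 \<le> int b - 14 * int s" by linarith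
    moreover have "b \<le> 14 * s + 56" using linked_bounds(3) [OF l'(1)] le(1) s by simp
    then have "int b - 14 * int s \<le> 56" by linarith
    ultimately have b: "int b - 14 * int s \<in> set [14..56]"
      unfolding set_upto atLeastAtMost_iff by blast
    have "d = b"
      by (rule no_four_cycle_window [OF window_kinds(2) [OF M s(2,1)] b l'(1) l(2) l'(4) l(3)])
        (use le g min s dis in auto)
    then show False using dis by simp
  qed
qed

lemma spiral_no_four_cycle:
  assumes M: "3 \<le> M"
  shows "\<not> contains_copy (spiral M) (cycle_graph 4)"
proof
  assume "contains_copy (spiral M) (cycle_graph 4)"
  then obtain a b c d where abcd: "distinct [a, b, c, d]"
    and "{{a, b}, {b, c}, {c, d}, {d, a}} \<subseteq> spiral_edges M"
    unfolding contains_cycle_4 snd_conv by (elim exE conjE) (rule that)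
  then have e: "{a, b} \<in> spiral_edges M" "{b, c} \<in> spiral_edges M" "{c, d} \<in> spiral_edges M" "{d, a} \<in> spiral_edges M"
    by simp_all
  obtain g1 where g1: "linked M g1 a b" using spiral_edge_linked [OF e(1)] by blast
  obtain g2 where g2: "linked M g2 b c" using spiral_edge_linked [OF e(2)] by blast
  obtain g3 where g3: "linked M g3 c d" using spiral_edge_linked [OF e(3)] by blast
  obtain g4 where g4: "linked M g4 d a" using spiral_edge_linked [OF e(4)] by blast
  have ne: "a \<noteq> c" "b \<noteq> d" using abcd by auto
  consider "g1 \<le> g2" "g1 \<le> g3" "g1 \<le> g4" | "g2 \<le> g3" "g2 \<le> g4" "g2 \<le> g1"
    | "g3 \<le> g4" "g3 \<le> g1" "g3 \<le> g2" | "g4 \<le> g1" "g4 \<le> g2" "g4 \<le> g3" by linarith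
  then show False
  proof cases
    case 1
    then show False by (rule no_four_cycle_min [OF M ne g1 g2 g3 g4])
  next
    case 2
    then show False by (rule no_four_cycle_min [OF M ne(2) ne(1) [symmetric] g2 g3 g4 g1])
  next
    case 3
    then show False by (rule no_four_cycle_min [OF M ne(1) [symmetric] ne(2) [symmetric] g3 g4 g1 g2])
  next
    case 4
    then show False by (rule no_four_cycle_min [OF M ne(2) [symmetric] ne(1) g4 g1 g2 g3])
  qed
qed

section \<open>Counting the triangles of the spiral graphs\<close>

definition spiral_triangles :: "nat \<Rightarrow> nat \<Rightarrow> (nat \<times> nat \<times> nat) set" where
  "spiral_triangles M g = (\<lambda>(a, b, c). (14 * g + a, 14 * g + b, 14 * g + c)) ` set (triangles (part_of M g))"

lemma triangles_bounds:
  assumes "(a, b, c) \<in> set (triangles k)"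
  shows "a < b" "b < c" "14 \<le> c" "c \<le> 28" "k \<noteq> Outer \<Longrightarrow> c < 28"
  using assms by (cases k; auto)+

lemma card_spiral_triangles:
  assumes "1 \<le> M"
  shows "card (\<Union>g\<le>M. spiral_triangles M g) = 10 * (M + 1)"
proof -
  have "card (spiral_triangles M g) = length (triangles (part_of M g))" for g
  proof -
    have "distinct (triangles (part_of M g))" by (cases "part_of M g") simp_all
    moreover have "inj_on (\<lambda>(a, b, c). (14 * g + a, 14 * g + b, 14 * g + c)) A" for A
      by (auto simp: inj_on_def)
    ultimately show ?thesis
      unfolding spiral_triangles_def by (simp add: card_image distinct_card)
  qed
  then have card: "card (spiral_triangles M g) = 10 + (if g = M then 2 else 0) - (if g = 0 then 2 else 0)" if "g \<le> M" for g
    using that assms by (auto simp: part_of_def)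
  \<comment> \<open>The largest vertex of a triangle lies on the outer ring of its part, or is the
    extra vertex, and so determines the part.\<close>
  have disj: "spiral_triangles M g \<inter> spiral_triangles M h = {}" if "g < h" "h \<le> M" for g h
  proof (rule ccontr)
    assume "spiral_triangles M g \<inter> spiral_triangles M h \<noteq> {}"
    then obtain a b c a' b' c' where t: "(a, b, c) \<in> set (triangles (part_of M g))"
      "(a', b', c') \<in> set (triangles (part_of M h))" "14 * g + c = 14 * h + c'"
      unfolding spiral_triangles_def by auto
    have "part_of M g \<noteq> Outer" using that by (simp add: part_of_def)
    then have "c < 28" "14 \<le> c'" using triangles_bounds t by blast+
    then show False using t(3) that(1) by linarith
  qed
  have "card (\<Union>g\<le>M. spiral_triangles M g) = (\<Sum>g\<le>M. card (spiral_triangles M g))"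
  proof (rule card_UN_disjoint)
    show "\<forall>g\<in>{..M}. \<forall>h\<in>{..M}. g \<noteq> h \<longrightarrow> spiral_triangles M g \<inter> spiral_triangles M h = {}"
      using disj by (metis Int_commute atMost_iff linorder_neqE_nat)
  qed (simp_all add: spiral_triangles_def)
  also have "\<dots> = (\<Sum>g\<le>M. 10 + (if g = M then 2 else 0) - (if g = 0 then 2 else 0))"
    using card by simp
  also have "\<dots> = 10 * (M + 1)"
  proof -
    obtain N where N: "M = Suc N" using assms by (cases M) auto
    have "(\<Sum>g\<le>M. 10 + (if g = M then 2 else 0) - (if g = 0 then 2 else 0)) =
        12 + (\<Sum>g\<le>N. 10 - (if g = 0 then 2 else 0 :: nat))"
      unfolding N by simp
    also have "(\<Sum>g\<le>N. 10 - (if g = 0 then 2 else 0 :: nat)) = 8 + (\<Sum>g<N. 10)"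
      by (simp add: sum.atMost_shift)
    finally show ?thesis by (simp add: N)
  qed
  finally show ?thesis .
qed

text \<open>Increasing triples name each triangle once. That there are no further triangles follows
  later from the general upper bound.\<close>

lemma spiral_copies:
  assumes "1 \<le> M"
  shows "10 * (M + 1) \<le> card (copies (cycle_graph 3) (spiral M))"
proof -
  let ?S = "\<Union>g\<le>M. spiral_triangles M g"
  let ?f = "\<lambda>(x, y, z). triangle_on x y z"
  have sorted: "x < y \<and> y < z" if "(x, y, z) \<in> ?S" for x y z
    using that triangles_bounds(1,2) unfolding spiral_triangles_def by fastforce
  have "inj_on ?f ?S"
  proof (rule inj_onI, clarsimp)
    fix x y z x' y' z' g h
    assume *: "(x, y, z) \<in> spiral_triangles M g" "g \<le> M" "(x', y', z') \<in> spiral_triangles M h" "h \<le> M"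
      "triangle_on x y z = triangle_on x' y' z'"
    then have s: "x < y" "y < z" "x' < y'" "y' < z'" using sorted by blast+
    have "{x, y, z} = {x', y', z'}" using *(5) by (simp add: triangle_on_def)
    then have "x \<in> {x', y', z'}" "y \<in> {x', y', z'}" "z \<in> {x', y', z'}"
      "x' \<in> {x, y, z}" "y' \<in> {x, y, z}" "z' \<in> {x, y, z}" by blast+
    then show "x = x' \<and> y = y' \<and> z = z'" using s by auto
  qed
  moreover have "?f ` ?S \<subseteq> copies (cycle_graph 3) (spiral M)"
  proof
    fix H assume "H \<in> ?f ` ?S"
    then obtain g a b c where g: "g \<le> M" and t: "(a, b, c) \<in> set (triangles (part_of M g))"
      and H: "H = triangle_on (14 * g + a) (14 * g + b) (14 * g + c)"
      by (auto simp: spiral_triangles_def)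
    have l: "(a, b) \<in> set (links (part_of M g))" "(a, c) \<in> set (links (part_of M g))" "(b, c) \<in> set (links (part_of M g))"
      using t unfolding links_def by force+
    have "{14 * g + a, 14 * g + b} \<in> spiral_edges M" "{14 * g + a, 14 * g + c} \<in> spiral_edges M"
      "{14 * g + b, 14 * g + c} \<in> spiral_edges M"
      unfolding spiral_edges_def using g l by blast+
    then show "H \<in> copies (cycle_graph 3) (spiral M)"
      unfolding copies_cycle_3 H using spiral_edge_in [OF g l(1)] spiral_edge_in [OF g l(3)]
      by (intro CollectI exI [of _ "14 * g + a"] exI [of _ "14 * g + b"] exI [of _ "14 * g + c"]) auto
  qed
  ultimately show ?thesis
    using card_inj_on_le finite_copies [OF simple_spiral] card_spiral_triangles [OF assms] by metis
qed

section \<open>The extremal number\<close>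

lemma planar_edgeless: "planar ({..<n::nat}, {})"
proof -
  have "plane_drawing ({..<n}, {}) of_nat \<gamma>" for \<gamma> :: "nat set \<Rightarrow> real \<Rightarrow> complex"
    by (simp add: plane_drawing_def inj_on_def)
  then show ?thesis unfolding planar_def by blast
qed

text \<open>The bound on copies makes the set of counts finite and the edgeless graph makes it
  nonempty, so \<open>Max\<close> is a true maximum.\<close>

lemma ex_planar_attained:
  assumes n: "4 \<le> n"
  obtains G :: "nat graph" where "simple_graph G" "card (verts G) = n" "planar G"
    "\<not> contains_copy G (cycle_graph 4)"
    "ex_planar n (cycle_graph 3) (cycle_graph 4) = card (copies (cycle_graph 3) G)"
    "\<And>G' :: nat graph. simple_graph G' \<Longrightarrow> card (verts G') = n \<Longrightarrow> planar G' \<Longrightarrow>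
      \<not> contains_copy G' (cycle_graph 4) \<Longrightarrow>
      card (copies (cycle_graph 3) G') \<le> ex_planar n (cycle_graph 3) (cycle_graph 4)"
proof -
  define A where "A = {card (copies (cycle_graph 3) G) | G :: nat graph.
      simple_graph G \<and> card (verts G) = n \<and> planar G \<and> \<not> contains_copy G (cycle_graph 4)}"
  have "k \<le> 5 * n" if k: "k \<in> A" for k
  proof -
    obtain G :: "nat graph" where "k = card (copies (cycle_graph 3) G)" "simple_graph G" "card (verts G) = n"
      "planar G" "\<not> contains_copy G (cycle_graph 4)" using k unfolding A_def by blast
    then show ?thesis using copies_bound [of G] n by simp
  qed
  then have fin: "finite A" by (meson finite_nat_set_iff_bounded_le)
  have "card (copies (cycle_graph 3) ({..<n}, {} :: nat set set)) \<in> A"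
    unfolding A_def
    by (intro CollectI exI [of _ "({..<n}, {})"])
      (auto simp: simple_graph_def planar_edgeless contains_cycle_4)
  then have "Max A \<in> A" using fin Max_in by blast
  moreover have ex: "ex_planar n (cycle_graph 3) (cycle_graph 4) = Max A"
    by (simp add: ex_planar_def A_def)
  ultimately obtain G :: "nat graph" where "Max A = card (copies (cycle_graph 3) G)" "simple_graph G"
    "card (verts G) = n" "planar G" "\<not> contains_copy G (cycle_graph 4)" unfolding A_def by blast
  moreover have "card (copies (cycle_graph 3) G') \<le> Max A"
    if "simple_graph G'" "card (verts G') = n" "planar G'" "\<not> contains_copy G' (cycle_graph 4)" for G' :: "nat graph"
    unfolding A_def [symmetric] using that
    by (intro Max_ge fin) (simp only: A_def, intro CollectI exI [of _ G'], simp)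
  ultimately show ?thesis using that [of G] ex by simp
qed

lemma ex_planar_upper: "4 \<le> n \<Longrightarrow> 7 * ex_planar n (cycle_graph 3) (cycle_graph 4) + 10 \<le> 5 * n"
  by (rule ex_planar_attained [of n], assumption) (metis copies_bound)

lemma ex_planar_spiral:
  assumes M: "3 \<le> M"
  shows "ex_planar (14 * M + 16) (cycle_graph 3) (cycle_graph 4) = 10 * (M + 1)"
proof -
  have n: "4 \<le> 14 * M + 16" "card (verts (spiral M)) = 14 * M + 16"
    by (simp_all add: spiral_verts_def)
  have "card (copies (cycle_graph 3) (spiral M)) \<le> ex_planar (14 * M + 16) (cycle_graph 3) (cycle_graph 4)"
  proof (rule ex_planar_attained [OF n(1)])
    assume "\<And>G' :: nat graph. simple_graph G' \<Longrightarrow> card (verts G') = 14 * M + 16 \<Longrightarrow> planar G' \<Longrightarrow>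
      \<not> contains_copy G' (cycle_graph 4) \<Longrightarrow>
      card (copies (cycle_graph 3) G') \<le> ex_planar (14 * M + 16) (cycle_graph 3) (cycle_graph 4)"
    from this [OF simple_spiral n(2) planar_spiral spiral_no_four_cycle [OF M]] M show ?thesis by simp
  qed
  then have "10 * (M + 1) \<le> ex_planar (14 * M + 16) (cycle_graph 3) (cycle_graph 4)"
    using spiral_copies [of M] M by linarith
  \<comment> \<open>The general bound is exact here: 5 (14 M + 16) - 10 = 70 (M + 1).\<close>
  moreover have "ex_planar (14 * M + 16) (cycle_graph 3) (cycle_graph 4) \<le> 10 * (M + 1)"
    using ex_planar_upper [OF n(1)] by simp
  ultimately show ?thesis by (rule antisym [rotated])
qed

theorem theorem4:
  shows "(\<forall>n::nat. n \<ge> 4 \<longrightarrow>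
            real (ex_planar n (cycle_graph 3) (cycle_graph 4)) \<le> 5 / 7 * (real n - 2)) \<and>
         infinite {n::nat. n \<ge> 4 \<and>
            real (ex_planar n (cycle_graph 3) (cycle_graph 4)) = 5 / 7 * (real n - 2)}"
proof (intro conjI allI impI)
  fix n :: nat assume "n \<ge> 4"
  then have "real (7 * ex_planar n (cycle_graph 3) (cycle_graph 4) + 10) \<le> real (5 * n)"
    using ex_planar_upper by (simp only: of_nat_le_iff)
  then show "real (ex_planar n (cycle_graph 3) (cycle_graph 4)) \<le> 5 / 7 * (real n - 2)" by simp
next
  have "infinite (range (\<lambda>k::nat. 14 * (k + 3) + 16))"
    by (intro range_inj_infinite) (simp add: inj_def)
  moreover have "range (\<lambda>k::nat. 14 * (k + 3) + 16) \<subseteq> {n. n \<ge> 4 \<and>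
      real (ex_planar n (cycle_graph 3) (cycle_graph 4)) = 5 / 7 * (real n - 2)}"
  proof clarify
    fix k :: nat
    show "14 * (k + 3) + 16 \<ge> 4 \<and> real (ex_planar (14 * (k + 3) + 16) (cycle_graph 3) (cycle_graph 4)) =
        5 / 7 * (real (14 * (k + 3) + 16) - 2)"
      using ex_planar_spiral [of "k + 3"] by simp
  qed
  ultimately show "infinite {n::nat. n \<ge> 4 \<and>
      real (ex_planar n (cycle_graph 3) (cycle_graph 4)) = 5 / 7 * (real n - 2)}"
    by (rule infinite_super [rotated])
qed

end
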